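(* Let $\mathbb F$ be a field, and let $n,k$ be integers with $k\ge 4$, $n\ge k+2$, $n+k$ even, and $|\mathbb F|>k$. Let $T\colon \mathcal M_{n\,k}(\mathbb F)\to\mathcal M_{n\,k}(\mathbb F)$ be a linear map. Then $\det_{n\,k}(T(X))=\det_{n\,k}(X)$ for all $X\in\mathcal M_{n\,k}(\mathbb F)$ if and only if there exist $A\in\mathcal M_{n\,n}(\mathbb F)$ and $B\in\mathcal M_{k\,k}(\mathbb F)$ such that \[ \det_{n\,k}\bigl(A(|i_1,\ldots,i_k]\bigr)\cdot\det_k(B)=(-1)^{i_1+\cdots+i_k-1-2-\cdots-k} \] for all $1\le i_1<\cdots<i_k\le n$, and $T(X)=AXB$ for all $X\in\mathcal M_{n\,k}(\mathbb F)$.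
   Context: $\mathcal M_{n\,k}(\mathbb F)$ denotes the $n\times k$ matrices over $\mathbb F$. The condition $|\mathbb F|>k$ means $\mathbb F$ is infinite, or finite with more than $k$ elements. For $X\in\mathcal M_{n\,k}(\mathbb F)$ and $J\subseteq[n]$, $X[J|)$ denotes the submatrix formed by the rows with indices in $J$ (all columns); for $A\in\mathcal M_{n\,n}(\mathbb F)$, $A(|i_1,\ldots,i_k]$ denotes the $n\times k$ submatrix formed by the columns $i_1,\ldots,i_k$ (in this order). For $n\ge k\ge1$ the Cullis determinant of $X\in\mathcal M_{n\,k}(\mathbb F)$ is \[ \det_{n\,k}(X)=\sum_{1\le c_1<\cdots<c_k\le n}(-1)^{\sum_{\alpha=1}^k(c_\alpha-\alpha)}\det\bigl(X[c_1,\ldots,c_k|)\bigr), \] an alternating sum of the $k\times k$ row-minors; for $n=k$ it is the ordinary determinant, written $\det_k$. *)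

theory Defs
  imports
    "Jordan_Normal_Form.Determinant"
    "Jordan_Normal_Form.DL_Submatrix"
    "Jordan_Normal_Form.VS_Connect"
begin

text \<open>
  An increasing sequence \<open>c\<^sub>1 < \<dots> < c\<^sub>k\<close> of row indices is given by the set \<open>J\<close> of its
  members; \<open>pick J\<close> enumerates \<open>J\<close> increasingly. Indices are 0-based, so \<open>pick J a\<close> is
  \<open>c\<^sub>\<alpha> - 1\<close> for \<open>\<alpha> = a + 1\<close>, and \<open>c\<^sub>\<alpha> - \<alpha> = pick J a - a\<close>. The subtraction on \<open>nat\<close> is
  never truncated (lemma \<open>le_pick\<close>).
\<close>

definition cullis_det :: "'a :: comm_ring_1 mat \<Rightarrow> 'a" where
  "cullis_det X =
     (\<Sum>J | J \<subseteq> {..<dim_row X} \<and> card J = dim_col X.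
        (- 1) ^ (\<Sum>a<dim_col X. pick J a - a) * det (submatrix X J UNIV))"

lemma le_pick:
  assumes "a < card J"
  shows "a \<le> pick J a"
  using assms
proof (induction a)
  case (Suc a)
  then have "a \<le> pick J a" by simp
  also have "pick J a < pick J (Suc a)" using Suc.prems by (intro pick_mono_le) auto
  finally show ?case by simp
qed simp

lemma cullis_det_square:
  assumes X: "X \<in> carrier_mat k k"
  shows "cullis_det X = det X"
proof -
  have J: "{J. J \<subseteq> {..<k} \<and> card J = k} = {{..<k}}"
    by (auto dest: card_subset_eq[OF finite_lessThan])
  have pick: "pick {..<k} a = a" if "a < k" for a
  proof -
    have "{b \<in> {..<k}. b < a} = {..<a}" using that by auto
    then show ?thesis using that pick_card_in_set[of a "{..<k}"] by simp
  qed
  have "submatrix X {..<k} UNIV = X"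
    using X by (intro eq_matI) (auto simp: submatrix_def pick pick_UNIV)
  then show ?thesis using X by (simp add: cullis_det_def J pick)
qed

end

theory Submission
  imports Defs
begin

text \<open>
  The Cullis determinant \<open>f\<close> is an alternating multilinear form in the columns and satisfies the
  Laplace expansion along columns. If two columns \<open>y\<close>, \<open>z\<close> are linearly independent, \<open>k \<ge> 4\<close> and
  \<open>n + k\<close> is even, then \<open>y\<close>, \<open>z\<close> can be completed to a matrix with \<open>f \<noteq> 0\<close>: unit vectors in the
  remaining columns delete rows and reduce to \<open>k = 4\<close>, where \<open>f (y, z, e\<^sub>i, e\<^sub>j)\<close> is, up to signs, the
  Pfaffian of a nondegenerate alternating form on the four columns. If it vanished for all \<open>i < j\<close>, the
  2 x 2 minors of the images of \<open>y\<close>, \<open>z\<close> in the dual space would all be equal, hence zero by the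
  Pluecker relation.

  Consequently a linear \<open>T\<close> preserving \<open>f\<close> is injective, and the matrices \<open>Y\<close> of rank at most one are
  exactly those for which \<open>f (X + c Y)\<close> is affine in \<open>c\<close> for all \<open>X\<close>, so that \<open>T\<close> preserves them.
  As \<open>n > k\<close>, \<open>T\<close> maps \<open>{x y\<^sup>T | x}\<close> onto a space of the same form, which forces \<open>T X = A X B\<close>.
  The condition on \<open>A\<close> and \<open>B\<close> is the invariance of \<open>f\<close> on matrices of unit columns, which suffices by
  multilinearity.
\<close>

section \<open>Laplace expansion\<close>

lemma minus_one_power_cong:
  assumes "even (a + b)"
  shows "(- 1 :: 'a :: comm_ring_1) ^ a = (- 1) ^ b"
  using assms by (metis even_add neg_one_even_power neg_one_odd_power)

lemma pick_image:
  assumes "finite J"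
  shows "pick J ` {..<card J} = J"
proof -
  have "inj_on (pick J) {..<card J}"
    by (rule inj_onI) (metis lessThan_iff linorder_neqE_nat less_irrefl pick_mono_le)
  then have "card (pick J ` {..<card J}) = card J" by (simp add: card_image)
  moreover have "pick J ` {..<card J} \<subseteq> J" using pick_in_set_le by auto
  ultimately show ?thesis using assms by (simp add: card_subset_eq)
qed

lemma bij_betw_pick:
  assumes "finite J"
  shows "bij_betw (pick J) {..<card J} J"
  using pick_image[OF assms] by (metis bij_betw_def card_lessThan eq_card_imp_inj_on finite_lessThan)

lemma sum_pick:
  assumes "finite J"
  shows "(\<Sum>a<card J. g (pick J a)) = sum g J"
  by (rule sum.reindex_bij_betw[OF bij_betw_pick[OF assms]])

text \<open>Adding \<open>\<Sum>{..<k}\<close> instead of subtracting it keeps the parity, so the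
  sign can be handled without subtraction on naturals.\<close>

lemma pick_sign:
  assumes "finite J" "card J = k"
  shows "(- 1 :: 'a :: comm_ring_1) ^ (\<Sum>a<k. pick J a - a) = (- 1) ^ (\<Sum>J + \<Sum>{..<k})"
proof -
  have "(\<Sum>a<k. pick J a - a) + \<Sum>{..<k} = (\<Sum>a<k. pick J a)"
    unfolding sum.distrib[symmetric] using assms(2) le_pick[of _ J] by (intro sum.cong) auto
  also have "\<dots> = \<Sum>J" using sum_pick[OF assms(1), of "\<lambda>x. x"] assms(2) by simp
  finally show ?thesis by (intro minus_one_power_cong) presburger
qed

lemma cullis_det_alt:
  assumes "X \<in> carrier_mat n k"
  shows "cullis_det X = (\<Sum>J | J \<subseteq> {..<n} \<and> card J = k.
    (- 1) ^ (\<Sum>J + \<Sum>{..<k}) * det (submatrix X J UNIV))"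
  unfolding cullis_det_def using assms
  by (intro sum.cong) (auto simp: pick_sign finite_subset[OF _ finite_lessThan])

lemma submatrix_rows:
  assumes "X \<in> carrier_mat n k" "J \<subseteq> {..<n}"
  shows "submatrix X J UNIV = mat (card J) k (\<lambda>(a, b). X $$ (pick J a, b))"
proof -
  have "{i. i < n \<and> i \<in> J} = J" using assms by auto
  then show ?thesis using assms by (simp add: submatrix_def pick_UNIV)
qed

section \<open>Deleting a row: index sets with and without a given element\<close>

lemma mat_delete_insert_index:
  assumes "a < dim_row X - 1" "b < dim_col X - 1"
  shows "mat_delete X i j $$ (a, b) = X $$ (insert_index i a, insert_index j b)"
  using assms by (simp add: mat_delete_def insert_index_def)

lemma insert_index_less_iff: "insert_index i a < insert_index i b \<longleftrightarrow> a < b"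
  by (auto simp: insert_index_def)

lemma index_neq_insert_index [simp]: "i \<noteq> insert_index i a"
  by (metis insert_index_exclude)

lemma insert_index_less: "a < n \<Longrightarrow> insert_index i a < Suc n"
  by (auto simp: insert_index_def)

text \<open>A set \<open>J\<close> containing \<open>i\<close> corresponds to a set \<open>K\<close> of row indices of the matrix with row \<open>i\<close>
  deleted; \<open>insert_index i\<close> is the increasing enumeration of the complement of \<open>{i}\<close>.\<close>

context
  fixes i n :: nat and K J :: "nat set"
  assumes i: "i < Suc n" and K: "K \<subseteq> {..<n}" and J_def: "J = insert i (insert_index i ` K)"
begin

private lemma finite_K: "finite K"
  using K finite_subset by auto

lemma card_insert_index_image: "card J = Suc (card K)"
  unfolding J_def using finite_K
  by (subst card_insert_disjoint) (auto simp: card_image insert_index_inj_on)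

lemma insert_index_image_below: "card {a \<in> J. a < i} = card {a \<in> K. a < i}"
proof -
  have "{a \<in> J. a < i} = {a \<in> K. a < i}"
    unfolding J_def by (auto simp: insert_index_def image_iff split: if_splits)
  then show ?thesis by simp
qed

text \<open>The index \<open>i\<close> has position \<open>card {a \<in> K. a < i}\<close> in
  \<open>J\<close>; off that position, \<open>J\<close> is enumerated as \<open>K\<close> shifted
  past \<open>i\<close>. This matches the minors of a matrix with those of the matrix without row
  \<open>i\<close>. The proof counts the elements of \<open>J\<close> below the claimed
  value.\<close>

lemma pick_insert_index:
  assumes "b < card K"
  shows "pick J (insert_index (card {a \<in> K. a < i}) b) = insert_index i (pick K b)"
proof -
  let ?t = "card {a \<in> K. a < i}" and ?x = "insert_index i (pick K b)"
  have pK: "pick K b \<in> K" using assms pick_in_set_le by blast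
  have xJ: "?x \<in> J" using pK by (auto simp: J_def)
  have eq: "{a \<in> J. a < ?x} = (if i \<le> pick K b then {i} else {}) \<union> insert_index i ` {a \<in> K. a < pick K b}"
    unfolding J_def by (auto simp: insert_index_less_iff) (auto simp: insert_index_def split: if_splits)
  have "card {a \<in> J. a < ?x} = (if i \<le> pick K b then 1 else 0) + card (insert_index i ` {a \<in> K. a < pick K b})"
    unfolding eq using finite_K by (subst card_Un_disjoint) auto
  also have "card (insert_index i ` {a \<in> K. a < pick K b}) = b"
    using card_pick_le[OF assms] by (simp add: card_image insert_index_inj_on)
  finally have c: "card {a \<in> J. a < ?x} = (if i \<le> pick K b then Suc b else b)" by simp
  have "i \<le> pick K b \<longleftrightarrow> ?t \<le> b"
  proof
    assume "i \<le> pick K b"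
    then show "?t \<le> b" using card_le_pick_le[OF assms] by blast
  next
    assume t: "?t \<le> b"
    show "i \<le> pick K b"
    proof (rule ccontr)
      assume "\<not> i \<le> pick K b"
      then have "insert (pick K b) {a \<in> K. a < pick K b} \<subseteq> {a \<in> K. a < i}" using pK by auto
      then have "card (insert (pick K b) {a \<in> K. a < pick K b}) \<le> ?t"
        using finite_K by (intro card_mono) auto
      then show False using t card_pick_le[OF assms] finite_K by simp
    qed
  qed
  then have "card {a \<in> J. a < ?x} = insert_index ?t b" unfolding c by (simp add: insert_index_def)
  then show ?thesis using pick_card_in_set[OF xJ] by simp
qed

text \<open>The shift raises the elements of \<open>K\<close> at or above \<open>i\<close> by one;
  counting those below \<open>i\<close> on the left avoids subtraction.\<close>

lemma sum_insert_index_image: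
  "\<Sum>J + card {a \<in> K. a < i} = i + \<Sum>K + card K"
proof -
  have "\<Sum>J = i + (\<Sum>a\<in>K. insert_index i a)"
    unfolding J_def using finite_K
    by (subst sum.insert) (auto simp: sum.reindex insert_index_inj_on o_def)
  also have "(\<Sum>a\<in>K. insert_index i a) = (\<Sum>a\<in>K. a + (if a < i then 0 else 1))"
    by (intro sum.cong) (auto simp: insert_index_def)
  also have "\<dots> = \<Sum>K + card {a \<in> K. \<not> a < i}"
    using finite_K by (simp add: sum.distrib sum.If_cases Int_def Collect_neg_eq[symmetric])
  finally have J: "\<Sum>J = i + (\<Sum>K + card {a \<in> K. \<not> a < i})" .
  have K_split: "{a \<in> K. a < i} \<union> {a \<in> K. \<not> a < i} = K" by auto
  have "card ({a \<in> K. a < i} \<union> {a \<in> K. \<not> a < i}) = card {a \<in> K. a < i} + card {a \<in> K. \<not> a < i}"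
    by (rule card_Un_disjoint) (use finite_K in auto)
  then have "card {a \<in> K. a < i} + card {a \<in> K. \<not> a < i} = card K" unfolding K_split by simp
  then show ?thesis using J by linarith
qed

end

text \<open>The inverse is the preimage under \<open>insert_index i\<close>, whose range is
  everything except \<open>i\<close>.\<close>

lemma bij_betw_insert_index_image:
  assumes "i < Suc n"
  shows "bij_betw (\<lambda>K. insert i (insert_index i ` K))
    {K. K \<subseteq> {..<n} \<and> card K = m} {J. J \<subseteq> {..<Suc n} \<and> card J = Suc m \<and> i \<in> J}"
proof -
  have vimg: "insert i (insert_index i ` (insert_index i -` J)) = J" if "J \<subseteq> {..<Suc n}" "i \<in> J" for J
  proof -
    have "J - {i} \<subseteq> range (insert_index i)"
    proof
      fix x assume "x \<in> J - {i}"
      then show "x \<in> range (insert_index i)"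
        by (intro image_eqI[of _ _ "delete_index i x"]) (auto simp: insert_index_def delete_index_def)
    qed
    then show ?thesis using that insert_index_exclude[of i] by (auto simp: image_vimage_eq)
  qed
  show ?thesis
  proof (rule bij_betwI[where g = "\<lambda>J. insert_index i -` J"])
    show "(\<lambda>K. insert i (insert_index i ` K)) \<in> {K. K \<subseteq> {..<n} \<and> card K = m} \<rightarrow> {J. J \<subseteq> {..<Suc n} \<and> card J = Suc m \<and> i \<in> J}"
      using assms by (auto simp: card_insert_index_image[OF assms] insert_index_less)
    show "(\<lambda>J. insert_index i -` J) \<in> {J. J \<subseteq> {..<Suc n} \<and> card J = Suc m \<and> i \<in> J} \<rightarrow> {K. K \<subseteq> {..<n} \<and> card K = m}"
    proof
      fix J assume J: "J \<in> {J. J \<subseteq> {..<Suc n} \<and> card J = Suc m \<and> i \<in> J}"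
      have sub: "insert_index i -` J \<subseteq> {..<n}" 
        using J assms by (auto simp: insert_index_def split: if_splits)
      then show "insert_index i -` J \<in> {K. K \<subseteq> {..<n} \<and> card K = m}"
        using card_insert_index_image[OF assms sub refl] vimg J by auto
    qed
    fix K :: "nat set"
    show "insert_index i -` insert i (insert_index i ` K) = K"
      using insert_index_exclude[of i] insert_index_inj_on[of i UNIV] by (auto dest: injD)
  next
    fix J assume "J \<in> {J. J \<subseteq> {..<Suc n} \<and> card J = Suc m \<and> i \<in> J}"
    then show "insert i (insert_index i ` (insert_index i -` J)) = J" using vimg by blast
  qed
qed

text \<open>Each minor is expanded along column \<open>j\<close>, and the pairs of \<open>J\<close>
  and \<open>i \<in> J\<close> are regrouped by \<open>i\<close>. For fixed \<open>i\<close> the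
  remaining sets \<open>K\<close> are the index sets of \<open>mat_delete X i j\<close>.\<close>

theorem cullis_det_laplace:
  assumes X: "X \<in> carrier_mat n k" and j: "j < k"
  shows "cullis_det X = (\<Sum>i<n. (- 1) ^ (i + j) * X $$ (i, j) * cullis_det (mat_delete X i j))"
proof (cases n)
  case 0
  then have "{J. J \<subseteq> {..<n} \<and> card J = k} = {}" using j by auto
  then show ?thesis unfolding cullis_det_alt[OF X] by (simp only:) (simp add: 0)
next
  case (Suc n')
  obtain k' where k: "k = Suc k'" using j by (cases k) auto
  let ?P = "\<lambda>n k. {J. J \<subseteq> {..<n} \<and> card J = k}"
  let ?s = "\<lambda>J k. (- 1 :: 'a) ^ (\<Sum>J + \<Sum>{..<k})"
  let ?M = "\<lambda>J. submatrix X J UNIV"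
  let ?t = "\<lambda>J i. card {a \<in> J. a < i}"
  have fin: "finite J" if "J \<in> ?P n k" for J using that finite_subset by auto
  \<comment> \<open>Ordinary Laplace expansion, reindexed from positions \<open>t\<close> to row
    indices \<open>i = pick J t\<close>; the position is recovered as \<open>?t J i\<close>.\<close>
  have J: "?s J k * det (?M J) =
    (\<Sum>i\<in>J. ?s J k * (X $$ (i, j) * ((- 1) ^ (?t J i + j) * det (mat_delete (?M J) (?t J i) j))))"
    if "J \<in> ?P n k" for J
  proof -
    have M: "?M J = mat k k (\<lambda>(a, b). X $$ (pick J a, b))" using submatrix_rows[OF X] that by auto
    then have "det (?M J) = (\<Sum>t<k. ?M J $$ (t, j) * ((- 1) ^ (t + j) * det (mat_delete (?M J) t j)))"
      using laplace_expansion_column[of "?M J" k j] j by (simp add: cofactor_def)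
    also have "\<dots> = (\<Sum>t<card J. X $$ (pick J t, j) *
        ((- 1) ^ (?t J (pick J t) + j) * det (mat_delete (?M J) (?t J (pick J t)) j)))"
      using that j by (intro sum.cong) (auto simp: M card_pick_le)
    also have "\<dots> = (\<Sum>i\<in>J. X $$ (i, j) * ((- 1) ^ (?t J i + j) * det (mat_delete (?M J) (?t J i) j)))"
      by (rule sum_pick[OF fin[OF that]])
    finally show ?thesis by (simp add: sum_distrib_left)
  qed
  let ?h = "\<lambda>J i. ?s J k * (X $$ (i, j) * ((- 1) ^ (?t J i + j) * det (mat_delete (?M J) (?t J i) j)))"
  have K: "?h (insert i (insert_index i ` K)) i =
      (- 1) ^ (i + j) * X $$ (i, j) * (?s K k' * det (submatrix (mat_delete X i j) K UNIV))"
    if i: "i < n" and K: "K \<in> ?P n' k'" for i K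
  proof -
    define J where "J = insert i (insert_index i ` K)"
    note KJ = i[unfolded Suc] K[simplified, THEN conjunct1] J_def
    have cK: "card K = k'" using K by simp
    have cJ: "card J = k" using card_insert_index_image[OF KJ] cK k by simp
    have J: "J \<subseteq> {..<n}" using K i Suc by (auto simp: J_def insert_index_less)
    have t: "?t J i = ?t K i" by (rule insert_index_image_below[OF KJ])
    have del: "mat_delete X i j \<in> carrier_mat n' k'" using X Suc k by (auto simp: mat_delete_def)
    have "mat_delete (?M J) (?t J i) j = submatrix (mat_delete X i j) K UNIV"
      unfolding submatrix_rows[OF X J] submatrix_rows[OF del KJ(2)] cJ
    proof (rule eq_matI)
      fix a b
      assume "a < dim_row (mat (card K) k' (\<lambda>(a, b). mat_delete X i j $$ (pick K a, b)))"
        and "b < dim_col (mat (card K) k' (\<lambda>(a, b). mat_delete X i j $$ (pick K a, b)))"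
      then have ab: "a < k'" "b < k'" "a < card K" using cK by auto
      have 1: "pick J (insert_index (?t K i) a) = insert_index i (pick K a)"
        by (rule pick_insert_index[OF KJ ab(3)])
      have 2: "pick K a < n'" using pick_in_set_le[OF ab(3)] KJ(2) by blast
      have 3: "insert_index (?t K i) a < Suc k'" "insert_index j b < Suc k'"
        using ab by (simp_all add: insert_index_less)
      have "mat_delete (mat k k (\<lambda>(a, b). X $$ (pick J a, b))) (?t J i) j $$ (a, b) =
          X $$ (pick J (insert_index (?t K i) a), insert_index j b)"
        using ab 3 unfolding k t by (simp add: mat_delete_insert_index)
      also have "\<dots> = mat_delete X i j $$ (pick K a, b)"
        unfolding 1 using ab 2 X Suc k by (simp add: mat_delete_insert_index)
      finally show "mat_delete (mat k k (\<lambda>(a, b). X $$ (pick J a, b))) (?t J i) j $$ (a, b) =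
          mat (card K) k' (\<lambda>(a, b). mat_delete X i j $$ (pick K a, b)) $$ (a, b)"
        using ab by simp
    qed (use cK k in auto)
    moreover have "?s J k * (- 1) ^ (?t J i + j) = (- 1) ^ (i + j) * ?s K k'"
      unfolding power_add[symmetric]
    proof (rule minus_one_power_cong)
      \<comment> \<open>One \<open>k'\<close> comes from shifting \<open>K\<close>, the other is the
        last summand of \<open>\<Sum>{..<k}\<close>; together they are even.\<close>
      have eq: "\<Sum>J + \<Sum>{..<k} + (?t J i + j) = i + j + (\<Sum>K + \<Sum>{..<k'}) + 2 * k'"
        using sum_insert_index_image[OF KJ] cK unfolding t k by simp
      have "even (b + 2 * c + b)" for b c :: nat by simp
      then show "even (\<Sum>J + \<Sum>{..<k} + (?t J i + j) + (i + j + (\<Sum>K + \<Sum>{..<k'})))"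
        unfolding eq .
    qed
    moreover have "s * (x * (p * d)) = q * x * (r * d)" if "s * p = q * r" for s x p d q r :: 'a
    proof -
      have "s * (x * (p * d)) = (s * p) * (x * d)" by (simp add: ac_simps)
      then show ?thesis unfolding that by (simp add: ac_simps)
    qed
    ultimately show ?thesis unfolding J_def[symmetric] by simp
  qed
  have "cullis_det X = (\<Sum>J\<in>?P n k. \<Sum>i\<in>J. ?h J i)"
    unfolding cullis_det_alt[OF X] by (intro sum.cong refl J)
  \<comment> \<open>Extension by zeros makes the inner range independent of \<open>J\<close>, so
    that the sums can be swapped.\<close>
  also have "\<dots> = (\<Sum>J\<in>?P n k. \<Sum>i<n. if i \<in> J then ?h J i else 0)"
    by (intro sum.cong refl sum.mono_neutral_cong_left) auto
  also have "\<dots> = (\<Sum>i<n. \<Sum>J\<in>?P n k. if i \<in> J then ?h J i else 0)" by (rule sum.swap)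
  also have "\<dots> = (\<Sum>i<n. \<Sum>J | J \<subseteq> {..<n} \<and> card J = k \<and> i \<in> J. ?h J i)"
    by (intro sum.cong refl sum.mono_neutral_cong_right) auto
  also have "\<dots> = (\<Sum>i<n. \<Sum>K\<in>?P n' k'. ?h (insert i (insert_index i ` K)) i)"
    unfolding Suc k
    by (intro sum.cong refl sum.reindex_bij_betw[OF bij_betw_insert_index_image, symmetric]) auto
  also have "\<dots> = (\<Sum>i<n. (- 1) ^ (i + j) * X $$ (i, j) * cullis_det (mat_delete X i j))"
  proof (rule sum.cong[OF refl])
    fix i assume i: "i \<in> {..<n}"
    have del: "mat_delete X i j \<in> carrier_mat n' k'" using X Suc k by (auto simp: mat_delete_def)
    show "(\<Sum>K\<in>?P n' k'. ?h (insert i (insert_index i ` K)) i) =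
        (- 1) ^ (i + j) * X $$ (i, j) * cullis_det (mat_delete X i j)"
      unfolding cullis_det_alt[OF del] sum_distrib_left using i by (intro sum.cong refl K) auto
  qed
  finally show ?thesis .
qed

text \<open>Selecting rows commutes with multiplication from the right, so every minor acquires the
  factor \<open>det B\<close>.\<close>

lemma cullis_det_mult_right:
  assumes X: "X \<in> carrier_mat n k" and B: "B \<in> carrier_mat k k"
  shows "cullis_det (X * B) = cullis_det X * det B"
proof -
  have "det (submatrix (X * B) J UNIV) = det (submatrix X J UNIV) * det B"
    if "J \<subseteq> {..<n}" "card J = k" for J
  proof -
    have "submatrix (X * B) J UNIV = submatrix X J UNIV * B"
      using that X B pick_in_set_le[of _ J]
      by (subst (1 2) submatrix_rows[of _ n k]) (auto simp: scalar_prod_def subset_iff intro!: eq_matI)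
    then show ?thesis using that X B by (simp add: det_mult[of _ k] submatrix_rows[OF X])
  qed
  moreover have "X * B \<in> carrier_mat n k" using X B by simp
  ultimately show ?thesis
    using X by (simp add: cullis_det_alt[of _ n k] sum_distrib_right mult.assoc)
qed

section \<open>Column operations\<close>

lemma mat_delete_cong_col:
  assumes "X \<in> carrier_mat n k" "Y \<in> carrier_mat n k"
    and "\<And>i j. i < n \<Longrightarrow> j < k \<Longrightarrow> j \<noteq> p \<Longrightarrow> X $$ (i, j) = Y $$ (i, j)"
  shows "mat_delete X i p = mat_delete Y i p"
  using assms by (intro eq_matI) (auto simp: mat_delete_def)

text \<open>In the expansion along column \<open>p\<close> the deleted matrices involve only the
  other columns, and these coincide for \<open>X\<close>, \<open>Y\<close> and
  \<open>Z\<close>.\<close>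

lemma cullis_det_col_linear:
  assumes X: "X \<in> carrier_mat n k" and Y: "Y \<in> carrier_mat n k" and Z: "Z \<in> carrier_mat n k"
    and p: "p < k"
    and XZ: "\<And>i j. i < n \<Longrightarrow> j < k \<Longrightarrow> j \<noteq> p \<Longrightarrow> X $$ (i, j) = Z $$ (i, j)"
    and YZ: "\<And>i j. i < n \<Longrightarrow> j < k \<Longrightarrow> j \<noteq> p \<Longrightarrow> Y $$ (i, j) = Z $$ (i, j)"
    and col: "\<And>i. i < n \<Longrightarrow> Z $$ (i, p) = a * X $$ (i, p) + b * Y $$ (i, p)"
  shows "cullis_det Z = a * cullis_det X + b * cullis_det Y"
proof -
  have del: "mat_delete X i p = mat_delete Z i p" "mat_delete Y i p = mat_delete Z i p" for i
    using mat_delete_cong_col[OF X Z XZ] mat_delete_cong_col[OF Y Z YZ] by auto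
  have "cullis_det Z = (\<Sum>i<n. a * ((- 1) ^ (i + p) * X $$ (i, p) * cullis_det (mat_delete X i p)) +
      b * ((- 1) ^ (i + p) * Y $$ (i, p) * cullis_det (mat_delete Y i p)))"
    unfolding cullis_det_laplace[OF Z p] del by (intro sum.cong) (simp_all add: col algebra_simps)
  then show ?thesis
    unfolding cullis_det_laplace[OF X p] cullis_det_laplace[OF Y p] sum.distrib sum_distrib_left .
qed

lemma cullis_det_col_zero:
  assumes X: "X \<in> carrier_mat n k" and p: "p < k" and "\<And>i. i < n \<Longrightarrow> X $$ (i, p) = 0"
  shows "cullis_det X = 0"
  unfolding cullis_det_laplace[OF X p] using assms by simp

lemma cullis_det_col_scale:
  assumes "Y \<in> carrier_mat n k" "Z \<in> carrier_mat n k" "p < k"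
    and "\<And>i j. i < n \<Longrightarrow> j < k \<Longrightarrow> j \<noteq> p \<Longrightarrow> Y $$ (i, j) = Z $$ (i, j)"
    and "\<And>i. i < n \<Longrightarrow> Z $$ (i, p) = c * Y $$ (i, p)"
  shows "cullis_det Z = c * cullis_det Y"
  using cullis_det_col_linear[OF assms(1,1,2,3,4,4), of c 0] assms(5) by simp

section \<open>Rank-one perturbations and polynomial dependence\<close>

definition outer_mat :: "nat \<Rightarrow> nat \<Rightarrow> (nat \<Rightarrow> 'a) \<Rightarrow> (nat \<Rightarrow> 'a) \<Rightarrow> 'a :: times mat" where
  "outer_mat n k x y = mat n k (\<lambda>(i, j). x i * y j)"

lemma outer_mat_carrier [simp]: "outer_mat n k x y \<in> carrier_mat n k"
  by (simp add: outer_mat_def)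

lemma outer_mat_dim [simp]: "dim_row (outer_mat n k x y) = n" "dim_col (outer_mat n k x y) = k"
  by (simp_all add: outer_mat_def)

lemma outer_mat_index [simp]:
  "i < n \<Longrightarrow> j < k \<Longrightarrow> outer_mat n k x y $$ (i, j) = x i * y j"
  by (simp add: outer_mat_def)

text \<open>After an invertible change of columns the perturbation sits in a single column, and the
  determinant is linear in that column.\<close>

lemma cullis_det_rank_one_update:
  fixes X :: "'a :: field mat"
  assumes X: "X \<in> carrier_mat n k"
  shows "\<exists>a b. \<forall>c. cullis_det (X + c \<cdot>\<^sub>m outer_mat n k x y) = a + c * b"
proof (cases "\<exists>p<k. y p \<noteq> 0")
  case False
  then have "X + c \<cdot>\<^sub>m outer_mat n k x y = X" for c using X by (intro eq_matI) auto
  then show ?thesis by (intro exI[of _ "cullis_det X"] exI[of _ 0]) simp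
next
  case True
  then obtain p where p: "p < k" "y p \<noteq> 0" by blast
  \<comment> \<open>\<open>C\<close> is the identity with row \<open>p\<close> replaced by
    \<open>y\<close>, and \<open>D\<close> is its inverse. \<open>E\<close> has \<open>x\<close> in
    column \<open>p\<close> and zeros elsewhere, so \<open>E * C\<close> is the rank-one
    matrix.\<close>
  define C where "C = mat k k (\<lambda>(i, j). if i = p then y j else if i = j then 1 else 0)"
  define D where "D = mat k k (\<lambda>(i, j). if i = p then (if j = p then 1 / y p else - y j / y p)
    else if i = j then 1 else 0)"
  define E where "E = mat n k (\<lambda>(i, j). if j = p then x i else 0)"
  have [simp]: "C \<in> carrier_mat k k" "D \<in> carrier_mat k k" "E \<in> carrier_mat n k"
    by (auto simp: C_def D_def E_def)
  have "D * C = 1\<^sub>m k"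
  proof (rule eq_matI)
    fix i j assume "i < dim_row (1\<^sub>m k :: 'a mat)" "j < dim_col (1\<^sub>m k :: 'a mat)"
    then have ij: "i < k" "j < k" by auto
    have "(D * C) $$ (i, j) = (\<Sum>l<k. D $$ (i, l) * C $$ (l, j))"
      using ij by (simp add: C_def D_def scalar_prod_def lessThan_atLeast0)
    also have "\<dots> = D $$ (i, p) * C $$ (p, j) + (\<Sum>l\<in>{..<k} - {p}. D $$ (i, l) * C $$ (l, j))"
      using p by (simp add: sum.remove)
    also have "(\<Sum>l\<in>{..<k} - {p}. D $$ (i, l) * C $$ (l, j)) =
        (\<Sum>l\<in>{..<k} - {p}. if l = j then D $$ (i, j) else 0)"
      using ij by (intro sum.cong) (auto simp: C_def)
    also have "\<dots> = (if j \<noteq> p then D $$ (i, j) else 0)"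
      using ij by (simp add: sum.delta')
    finally show "(D * C) $$ (i, j) = 1\<^sub>m k $$ (i, j)"
      using ij p by (auto simp: C_def D_def)
  qed (auto simp: C_def D_def)
  then have XDC: "X * D * C = X" using X by (simp add: assoc_mult_mat[of _ n k _ k _ k])
  have EC: "E * C = outer_mat n k x y"
  proof (rule eq_matI)
    fix i j assume "i < dim_row (outer_mat n k x y)" "j < dim_col (outer_mat n k x y)"
    then have ij: "i < n" "j < k" by auto
    have "(E * C) $$ (i, j) = (\<Sum>l<k. E $$ (i, l) * C $$ (l, j))"
      using ij by (simp add: C_def E_def scalar_prod_def lessThan_atLeast0)
    also have "\<dots> = (\<Sum>l<k. if l = p then x i * y j else 0)"
      using ij by (intro sum.cong) (auto simp: C_def E_def)
    finally show "(E * C) $$ (i, j) = outer_mat n k x y $$ (i, j)" using ij p by simp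
  qed (auto simp: C_def E_def)
  define Y where "Y = mat n k (\<lambda>(i, j). if j = p then x i else (X * D) $$ (i, j))"
  have XD: "X * D \<in> carrier_mat n k" using X by simp
  have "cullis_det (X + c \<cdot>\<^sub>m outer_mat n k x y) =
      cullis_det (X * D) * det C + c * (cullis_det Y * det C)" for c
  proof -
    have "X + c \<cdot>\<^sub>m outer_mat n k x y = (X * D + c \<cdot>\<^sub>m E) * C"
      using XD by (subst add_mult_distrib_mat[of _ n k _ _ k]) (simp_all add: XDC EC mult_smult_assoc_mat[of _ n k _ k])
    then have "cullis_det (X + c \<cdot>\<^sub>m outer_mat n k x y) = cullis_det (X * D + c \<cdot>\<^sub>m E) * det C"
      using XD by (simp add: cullis_det_mult_right[of _ n k])
    also have "cullis_det (X * D + c \<cdot>\<^sub>m E) = 1 * cullis_det (X * D) + c * cullis_det Y"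
      by (rule cullis_det_col_linear[of _ n k _ _ p])
        (use XD p in \<open>auto simp: Y_def E_def simp del: index_mult_mat(1)\<close>)
    finally show ?thesis by (simp add: algebra_simps)
  qed
  then show ?thesis by blast
qed

lemma cullis_det_no_cols:
  assumes X: "X \<in> carrier_mat n 0"
  shows "cullis_det X = 1"
proof -
  have "{J. J \<subseteq> {..<n} \<and> card J = 0} = {{}}" by (auto simp: finite_subset)
  then show ?thesis
    unfolding cullis_det_alt[OF X] by (simp add: submatrix_rows[OF X] det_dim_zero)
qed

text \<open>Expansion along column 0, inductively: every column contributes at most its own degree
  bound. The bound later limits the number of roots.\<close>

lemma cullis_det_poly:
  fixes M :: "nat \<Rightarrow> nat \<Rightarrow> 'a :: comm_ring_1 poly"
  assumes "\<And>i j. i < n \<Longrightarrow> j < k \<Longrightarrow> degree (M i j) \<le> d j"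
  shows "\<exists>P. degree P \<le> (\<Sum>j<k. d j) \<and>
    (\<forall>x. poly P x = cullis_det (mat n k (\<lambda>(i, j). poly (M i j) x)))"
  using assms
proof (induction k arbitrary: n M d)
  case 0
  show ?case by (rule exI[of _ 1]) (simp add: cullis_det_no_cols[of _ n])
next
  case (Suc k)
  let ?M = "\<lambda>i a b. M (insert_index i a) (Suc b)"
  have "\<exists>P. degree P \<le> (\<Sum>j<k. d (Suc j)) \<and>
    (\<forall>x. poly P x = cullis_det (mat (n - 1) k (\<lambda>(a, b). poly (?M i a b) x)))" for i
    by (rule Suc.IH, rule Suc.prems) (auto simp: insert_index_def)
  then obtain P where P: "\<And>i. degree (P i) \<le> (\<Sum>j<k. d (Suc j))"
    "\<And>i x. poly (P i) x = cullis_det (mat (n - 1) k (\<lambda>(a, b). poly (?M i a b) x))" by metis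
  let ?Q = "\<Sum>i<n. [:(- 1) ^ i:] * (M i 0 * P i)"
  have "degree ?Q \<le> (\<Sum>j<Suc k. d j)"
  proof (rule degree_sum_le)
    fix i assume "i \<in> {..<n}"
    have "degree ([:(- 1) ^ i:] * (M i 0 * P i)) \<le> degree (M i 0 * P i)"
      using degree_mult_le[of "[:(- 1) ^ i:]" "M i 0 * P i"] by simp
    also have "\<dots> \<le> degree (M i 0) + degree (P i)" by (rule degree_mult_le)
    also have "\<dots> \<le> d 0 + (\<Sum>j<k. d (Suc j))"
      using \<open>i \<in> {..<n}\<close> P(1) Suc.prems by (intro add_mono) auto
    finally show "degree ([:(- 1) ^ i:] * (M i 0 * P i)) \<le> (\<Sum>j<Suc k. d j)"
      by (simp only: sum.lessThan_Suc_shift)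
  qed simp
  moreover have "poly ?Q x = cullis_det (mat n (Suc k) (\<lambda>(i, j). poly (M i j) x))" for x
  proof -
    let ?X = "mat n (Suc k) (\<lambda>(i, j). poly (M i j) x)"
    have "cullis_det (mat_delete ?X i 0) = poly (P i) x" for i
      unfolding P(2)
      by (rule arg_cong[of _ _ cullis_det]) (auto simp: mat_delete_def insert_index_def intro!: eq_matI)
    then show ?thesis
      by (subst cullis_det_laplace[of ?X n "Suc k" 0]) (auto simp: poly_sum mult.assoc intro!: sum.cong)
  qed
  ultimately show ?case by blast
qed

section \<open>Completing two independent columns\<close>

text \<open>All positions of the two columns are allowed because inserting a further column shifts
  them.\<close>

definition completable :: "nat \<Rightarrow> nat \<Rightarrow> (nat \<Rightarrow> 'a :: comm_ring_1) \<Rightarrow> (nat \<Rightarrow> 'a) \<Rightarrow> bool" where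
  "completable n k y z \<longleftrightarrow> (\<forall>p q. p < k \<longrightarrow> q < k \<longrightarrow> p \<noteq> q \<longrightarrow>
    (\<exists>X \<in> carrier_mat n k. (\<forall>i<n. X $$ (i, p) = y i \<and> X $$ (i, q) = z i) \<and> cullis_det X \<noteq> 0))"

lemma insert_delete_index_eq: "a \<noteq> i \<Longrightarrow> insert_index i (delete_index i a) = a"
  by (auto simp: insert_index_def delete_index_def)

lemma delete_index_less: "i < Suc n \<Longrightarrow> a < Suc n \<Longrightarrow> a \<noteq> i \<Longrightarrow> delete_index i a < n"
  by (auto simp: delete_index_def)

lemma exists_third_index: "3 \<le> n \<Longrightarrow> \<exists>r<n. r \<noteq> p \<and> r \<noteq> q" for n p q :: nat
  by presburger

text \<open>The new column is the unit vector at row \<open>i\<close>. The expansion along it has a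
  single term, which is up to sign the determinant of the completion with row \<open>i\<close>
  removed.\<close>

lemma completable_Suc:
  assumes k: "2 \<le> k" and i: "i < Suc n"
    and c: "completable n k (y \<circ> insert_index i) (z \<circ> insert_index i)"
  shows "completable (Suc n) (Suc k) y z"
  unfolding completable_def
proof (intro allI impI)
  fix p q assume pq: "p < Suc k" "q < Suc k" "p \<noteq> q"
  obtain r where r: "r < Suc k" "r \<noteq> p" "r \<noteq> q"
    using exists_third_index[of "Suc k" p q] k by auto
  let ?d = "delete_index"
  have "?d r p \<noteq> ?d r q"
    using r pq insert_delete_index_eq[of p r] insert_delete_index_eq[of q r] by metis
  then obtain X where X: "X \<in> carrier_mat n k" "cullis_det X \<noteq> 0"
    "\<And>a. a < n \<Longrightarrow> X $$ (a, ?d r p) = y (insert_index i a) \<and> X $$ (a, ?d r q) = z (insert_index i a)"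
    using c[unfolded completable_def, rule_format, of "?d r p" "?d r q"] r pq
    by (auto simp: delete_index_less)
  \<comment> \<open>Row \<open>i\<close> is deleted in the only surviving term, so its entries off
    columns \<open>p\<close>, \<open>q\<close> and \<open>r\<close> are arbitrary;
    \<open>z i\<close> is a filler.\<close>
  define Y where "Y = mat (Suc n) (Suc k) (\<lambda>(a, b). if b = r then (if a = i then 1 else 0)
    else if a = i then (if b = p then y i else z i) else X $$ (?d i a, ?d r b))"
  have Y: "Y \<in> carrier_mat (Suc n) (Suc k)" by (simp add: Y_def)
  have "mat_delete Y i r = X"
    using X(1) by (intro eq_matI) (auto simp: mat_delete_insert_index Y_def insert_index_less)
  have "cullis_det Y = (\<Sum>a<Suc n. if a = i then (- 1) ^ (i + r) * cullis_det X else 0)"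
    unfolding cullis_det_laplace[OF Y r(1)]
    by (intro sum.cong) (use r \<open>mat_delete Y i r = X\<close> in \<open>auto simp: Y_def\<close>)
  then have "cullis_det Y = (- 1) ^ (i + r) * cullis_det X" using i by (simp only: sum.delta) simp
  then have "cullis_det Y \<noteq> 0" using X(2)
    by (metis (no_types, lifting) minus_one_power_iff minus_minus mult_1 mult_minus1 minus_equation_iff neg_equal_0_iff_equal)
  moreover have "Y $$ (a, p) = y a \<and> Y $$ (a, q) = z a" if "a < Suc n" for a
    using that r pq X(3)[of "?d i a"] i
    by (cases "a = i") (auto simp: Y_def delete_index_less insert_delete_index_eq)
  ultimately show "\<exists>X \<in> carrier_mat (Suc n) (Suc k).
      (\<forall>i<Suc n. X $$ (i, p) = y i \<and> X $$ (i, q) = z i) \<and> cullis_det X \<noteq> 0"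
    using Y by blast
qed

section \<open>The base case: two and four columns\<close>

definition order_sign :: "nat \<Rightarrow> nat \<Rightarrow> 'a :: comm_ring_1" where
  "order_sign a b = (if b < a then 1 else if a < b then - 1 else 0)"

lemma sum_insert_index:
  assumes "i < Suc n"
  shows "(\<Sum>a<n. g (insert_index i a)) = (\<Sum>a\<in>{..<Suc n} - {i}. g a)"
proof -
  have "bij_betw (insert_index i) {..<n} ({..<Suc n} - {i})"
    using insert_index_image[OF assms] insert_index_inj_on
    by (auto simp: bij_betw_def lessThan_atLeast0)
  then show ?thesis by (rule sum.reindex_bij_betw)
qed

text \<open>Removing row \<open>a\<close> moves the later rows by one, and \<open>order_sign\<close>
  records the resulting sign. Up to alternating signs, the determinant is the skew-symmetric
  bilinear form with matrix \<open>order_sign\<close>.\<close>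

lemma cullis_det_two_cols:
  assumes X: "X \<in> carrier_mat n 2"
  shows "cullis_det X = (\<Sum>a<n. \<Sum>b<n. order_sign a b * ((- 1) ^ (a + b) * (X $$ (a, 0) * X $$ (b, 1))))"
proof (cases n)
  case 0
  then show ?thesis using cullis_det_laplace[OF X, of 0] by simp
next
  case (Suc m)
  have "cullis_det (mat_delete X a 0) = (\<Sum>b<n. order_sign a b * ((- 1) ^ b * X $$ (b, 1)))"
    if "a < n" for a
  proof -
    have D: "mat_delete X a 0 \<in> carrier_mat m 1" using X Suc by (auto simp: mat_delete_def)
    have "cullis_det (mat_delete (mat_delete X a 0) b 0) = 1" for b
      using X Suc by (intro cullis_det_no_cols[of _ "m - 1"]) (auto simp: mat_delete_def)
    then have "cullis_det (mat_delete X a 0) = (\<Sum>b<m. (- 1) ^ b * X $$ (insert_index a b, 1))"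
      using cullis_det_laplace[OF D, of 0] X Suc
      by (auto simp: mat_delete_insert_index intro!: sum.cong)
    also have "\<dots> = (\<Sum>b<m. order_sign a (insert_index a b) *
        ((- 1) ^ insert_index a b * X $$ (insert_index a b, 1)))"
      by (intro sum.cong) (auto simp: order_sign_def insert_index_def)
    also have "\<dots> = (\<Sum>b\<in>{..<n} - {a}. order_sign a b * ((- 1) ^ b * X $$ (b, 1)))"
      unfolding Suc using that Suc by (intro sum_insert_index) auto
    also have "\<dots> = (\<Sum>b<n. order_sign a b * ((- 1) ^ b * X $$ (b, 1)))"
      by (intro sum.mono_neutral_left) (auto simp: order_sign_def)
    finally show ?thesis .
  qed
  then show ?thesis
    unfolding cullis_det_laplace[OF X zero_less_numeral]
    by (auto simp: sum_distrib_left power_add ac_simps intro!: sum.cong)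
qed

lemma completable_two:
  assumes nz: "(\<Sum>a<n. \<Sum>b<n. order_sign a b * ((- 1) ^ (a + b) * (y a * z b))) \<noteq> 0"
  shows "completable n 2 y z"
  unfolding completable_def
proof (intro allI impI)
  fix p q :: nat assume pq: "p < 2" "q < 2" "p \<noteq> q"
  let ?X = "mat n 2 (\<lambda>(i, j). if j = p then y i else z i)"
  let ?W = "\<lambda>y z. \<Sum>a<n. \<Sum>b<n. order_sign a b * ((- 1) ^ (a + b) * (y a * z b))"
  \<comment> \<open>The form is skew-symmetric, so either order of the two columns gives a nonzero
    value.\<close>
  have "?W z y = (\<Sum>b<n. \<Sum>a<n. order_sign a b * ((- 1) ^ (a + b) * (z a * y b)))" by (rule sum.swap)
  also have "\<dots> = - ?W y z"
    unfolding sum_negf[symmetric]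
    by (intro sum.cong) (auto simp: order_sign_def ac_simps)
  finally have "?W z y \<noteq> 0" using nz by simp
  moreover have "cullis_det ?X = (if p = 0 then ?W y z else ?W z y)"
    using pq by (subst cullis_det_two_cols[of _ n]) (auto intro!: sum.cong)
  ultimately show "\<exists>X \<in> carrier_mat n 2. (\<forall>i<n. X $$ (i, p) = y i \<and> X $$ (i, q) = z i) \<and> cullis_det X \<noteq> 0"
    using nz pq by (intro bexI[of _ ?X]) auto
qed

text \<open>This is the expansion of the Pfaffian of the skew-symmetric matrix \<open>order_sign\<close>
  restricted to the four indices \<open>a\<close>, \<open>b\<close>, \<open>i\<close>, \<open>j\<close>.\<close>

lemma order_sign_pfaffian:
  assumes "i < j"
  defines "e \<equiv> \<lambda>a. if a = i \<or> a = j then 0 else if i < a \<and> a < j then - 1 else 1 :: 'a :: comm_ring_1"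
  shows "order_sign a b - order_sign a b * (e a * e b) =
    order_sign j a * order_sign i b - order_sign i a * (order_sign j b :: 'a)"
  using assms(1) unfolding e_def order_sign_def by auto

text \<open>For even \<open>n\<close> the form is nondegenerate in every characteristic: consecutive
  equations differ by \<open>w i + w (Suc i)\<close>, pairing the entries makes their total sum
  vanish, and equation 0 then isolates \<open>w 0\<close>.\<close>

lemma order_sign_kernel:
  fixes w :: "nat \<Rightarrow> 'a :: comm_ring_1"
  assumes "even n" and ker: "\<And>i. i < n \<Longrightarrow> (\<Sum>a<n. order_sign i a * w a) = 0" and "a < n"
  shows "w a = 0"
proof -
  have adj: "w i + w (Suc i) = 0" if i: "Suc i < n" for i
  proof -
    have "0 = (\<Sum>a<n. order_sign (Suc i) a * w a) - (\<Sum>a<n. order_sign i a * w a)"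
      using ker[of i] ker[of "Suc i"] i by simp
    also have "\<dots> = (\<Sum>a<n. (if a = i then w i else 0) + (if a = Suc i then w (Suc i) else 0))"
      unfolding sum_subtractf[symmetric] by (intro sum.cong) (auto simp: order_sign_def)
    also have "\<dots> = w i + w (Suc i)" using i unfolding sum.distrib by simp
    finally show ?thesis by simp
  qed
  have sum: "(\<Sum>a<2 * m. w a) = 0" if "2 * m \<le> n" for m
    using that
  proof (induction m)
    case (Suc m)
    then show ?case using adj[of "2 * m"] by (simp add: add.assoc)
  qed simp
  have "w 0 = 0"
  proof -
    have n: "0 < n" using \<open>a < n\<close> by simp
    have "(\<Sum>a<n. order_sign 0 a * w a) + (\<Sum>a<n. w a) = (\<Sum>a<n. if a = 0 then w 0 else 0)"
      unfolding sum.distrib[symmetric] by (intro sum.cong) (auto simp: order_sign_def)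
    moreover have "(\<Sum>a<n. w a) = 0" using sum[of "n div 2"] \<open>even n\<close> by simp
    ultimately show ?thesis using ker[OF n] n by simp
  qed
  then show ?thesis using \<open>a < n\<close>
  proof (induction a)
    case (Suc a)
    then show ?case using adj[of a] by simp
  qed
qed

lemma completable_four:
  fixes y z :: "nat \<Rightarrow> 'a :: field"
  assumes m: "even m" "2 \<le> m" and ab: "a < m + 2" "b < m + 2" "y a * z b \<noteq> y b * z a"
  shows "completable (m + 2) 4 y z"
proof (rule ccontr)
  assume no: "\<not> ?thesis"
  let ?n = "m + 2"
  \<comment> \<open>The alternating signs are absorbed into \<open>u\<close> and \<open>v\<close>;
    \<open>al\<close> and \<open>be\<close> are their images under the form, and \<open>S\<close> is
    the value of the form on all rows.\<close>
  define u v where "u = (\<lambda>a. (- 1) ^ a * y a)" and "v = (\<lambda>a. (- 1) ^ a * z a)"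
  define al be where "al = (\<lambda>i. \<Sum>a<?n. order_sign i a * u a)"
    and "be = (\<lambda>i. \<Sum>a<?n. order_sign i a * v a)"
  define S where "S = (\<Sum>a<?n. \<Sum>b<?n. order_sign a b * (u a * v b))"
  have minors: "al j * be i - al i * be j = S" if ij: "i < j" "j < ?n" for i j
  proof -
    \<comment> \<open>The weight \<open>e\<close> is the sign change caused by removing rows
      \<open>i\<close> and \<open>j\<close>: rows between them move by one, rows beyond
      \<open>j\<close> by two. It is zero on the removed rows.\<close>
    define e :: "nat \<Rightarrow> 'a" where "e = (\<lambda>a. if a = i \<or> a = j then 0 else if i < a \<and> a < j then - 1 else 1)"
    let ?s = "\<lambda>a. insert_index j (insert_index i a)"
    \<comment> \<open>Otherwise unit columns at rows \<open>i\<close> and \<open>j\<close> would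
      complete \<open>y\<close> and \<open>z\<close>. As \<open>i < j\<close>, row \<open>i\<close>
      keeps its index when row \<open>j\<close> is removed first.\<close>
    have "\<not> completable m 2 (y \<circ> insert_index j \<circ> insert_index i) (z \<circ> insert_index j \<circ> insert_index i)"
      using no completable_Suc[of 2 i m "y \<circ> insert_index j" "z \<circ> insert_index j"]
        completable_Suc[of 3 j "Suc m" y z] ij by (auto simp: numeral_eq_Suc)
    then have "0 = (\<Sum>a<m. \<Sum>b<m. order_sign a b * ((- 1) ^ (a + b) * (y (?s a) * z (?s b))))"
      using completable_two[where n = m and y = "y \<circ> insert_index j \<circ> insert_index i" and z = "z \<circ> insert_index j \<circ> insert_index i"]
      by force
    also have "\<dots> = (\<Sum>a<m. \<Sum>b<m. order_sign (?s a) (?s b) * (e (?s a) * e (?s b)) * (u (?s a) * v (?s b)))"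
    proof (intro sum.cong refl)
      fix a b
      have sgn: "(- 1) ^ a = e (?s a) * (- 1) ^ ?s a" for a
        using ij by (auto simp: e_def insert_index_def)
      have u: "(- 1) ^ a * y (?s a) = e (?s a) * u (?s a)"
        unfolding u_def by (subst sgn) (simp only: mult.assoc)
      have v: "(- 1) ^ b * z (?s b) = e (?s b) * v (?s b)"
        unfolding v_def by (subst sgn) (simp only: mult.assoc)
      have "order_sign a b * ((- 1) ^ (a + b) * (y (?s a) * z (?s b))) =
          order_sign a b * (((- 1) ^ a * y (?s a)) * ((- 1) ^ b * z (?s b)))"
        by (simp add: power_add ac_simps)
      also have "\<dots> = order_sign a b * (e (?s a) * e (?s b)) * (u (?s a) * v (?s b))"
        unfolding u v by (simp only: ac_simps)
      finally have *: "order_sign a b * ((- 1) ^ (a + b) * (y (?s a) * z (?s b))) =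
          order_sign a b * (e (?s a) * e (?s b)) * (u (?s a) * v (?s b))" .
      have "order_sign (?s a) (?s b) = (order_sign a b :: 'a)"
        by (simp add: order_sign_def insert_index_less_iff)
      with * show "order_sign a b * ((- 1) ^ (a + b) * (y (?s a) * z (?s b))) =
          order_sign (?s a) (?s b) * (e (?s a) * e (?s b)) * (u (?s a) * v (?s b))" by (simp only:)
    qed
    also have "\<dots> = (\<Sum>a<?n. \<Sum>b<?n. order_sign a b * (e a * e b) * (u a * v b))"
    proof -
      have del: "(\<Sum>a<m. h (?s a)) = (\<Sum>a<?n. h a)" if h: "h i = 0" "h j = 0" for h :: "nat \<Rightarrow> 'a"
      proof -
        have "(\<Sum>a<m. h (?s a)) = (\<Sum>a\<in>{..<Suc m} - {i}. h (insert_index j a))"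
          using ij by (intro sum_insert_index) auto
        also have "\<dots> = (\<Sum>a<Suc m. h (insert_index j a))"
          using ij h by (intro sum.mono_neutral_left) auto
        also have "\<dots> = (\<Sum>a\<in>{..<Suc (Suc m)} - {j}. h a)"
          using ij by (intro sum_insert_index) auto
        also have "\<dots> = (\<Sum>a<?n. h a)"
          using ij h by (intro sum.mono_neutral_left) auto
        finally show ?thesis .
      qed
      let ?G = "\<lambda>a b. order_sign a b * (e a * e b) * (u a * v b)"
      have "(\<Sum>a<m. \<Sum>b<m. ?G (?s a) (?s b)) = (\<Sum>a<m. \<Sum>b<?n. ?G (?s a) b)"
        by (intro sum.cong refl del) (simp_all add: e_def)
      also have "\<dots> = (\<Sum>a<?n. \<Sum>b<?n. ?G a b)"
        by (rule del[of "\<lambda>a. \<Sum>b<?n. ?G a b"]) (simp_all add: e_def)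
      finally show ?thesis .
    qed
    finally have W: "(\<Sum>a<?n. \<Sum>b<?n. order_sign a b * (e a * e b) * (u a * v b)) = 0" by simp
    \<comment> \<open>Subtracting the vanishing sum \<open>W\<close> leaves the kernel of the
      Pfaffian identity, which splits into products of \<open>al\<close> and
      \<open>be\<close>.\<close>
    have "S = (\<Sum>a<?n. \<Sum>b<?n. (order_sign a b - order_sign a b * (e a * e b)) * (u a * v b))"
      unfolding left_diff_distrib sum_subtractf W S_def by simp
    also have "\<dots> = (\<Sum>a<?n. \<Sum>b<?n. (order_sign j a * u a) * (order_sign i b * v b) -
        (order_sign i a * u a) * (order_sign j b * v b))"
      unfolding e_def order_sign_pfaffian[OF ij(1)] by (simp add: algebra_simps)
    also have "\<dots> = al j * be i - al i * be j"
      unfolding al_def be_def sum_product sum_subtractf by simp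
    finally show ?thesis by simp
  qed
  \<comment> \<open>Three-term Pluecker relation for the indices 0, 1, 2, 3: all six minors equal
    \<open>S\<close>, so it reads \<open>S * S - S * S + S * S = 0\<close>.\<close>
  have "S * S = 0"
  proof -
    have "(al 1 * be 0 - al 0 * be 1) * (al 3 * be 2 - al 2 * be 3) -
        (al 2 * be 0 - al 0 * be 2) * (al 3 * be 1 - al 1 * be 3) +
        (al 3 * be 0 - al 0 * be 3) * (al 2 * be 1 - al 1 * be 2) = 0"
      by (simp add: algebra_simps)
    moreover have "al j * be i - al i * be j = S" if "i < j" "j < 4" for i j
      using that m by (intro minors) auto
    ultimately show ?thesis by simp
  qed
  then have par: "al i * be j = al j * be i" if "i < ?n" "j < ?n" for i j
    using minors[of i j] minors[of j i] that by (cases i j rule: linorder_cases) auto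
  have n: "even ?n" using m by simp
  have uv: "u i * s = v i * t" if h: "\<And>i. i < ?n \<Longrightarrow> al i * s = be i * t" and i: "i < ?n" for s t i
  proof -
    have "u i * s - v i * t = 0"
    proof (rule order_sign_kernel[OF n _ i])
      fix i assume i: "i < ?n"
      have "(\<Sum>a<?n. order_sign i a * (u a * s - v a * t)) = al i * s - be i * t"
        unfolding al_def be_def sum_distrib_right sum_subtractf[symmetric]
        by (intro sum.cong refl) (simp add: algebra_simps)
      then show "(\<Sum>a<?n. order_sign i a * (u a * s - v a * t)) = 0"
        using h[OF i] by (simp only: diff_self)
    qed
    then show ?thesis by simp
  qed
  \<comment> \<open>Nondegeneracy, in the form of \<open>uv\<close>, is used twice: first with
    coefficients \<open>be j\<close> and \<open>al j\<close>, then with \<open>v b\<close> and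
    \<open>u b\<close>.\<close>
  have "u i * be j = v i * al j" if "i < ?n" "j < ?n" for i j
    by (rule uv) (use par that in \<open>auto simp: ac_simps\<close>)
  then have "u a * v b = v a * u b"
    by (intro uv) (use ab in \<open>auto simp: ac_simps\<close>)
  then have "(- 1) ^ (a + b) * (y a * z b) = (- 1) ^ (a + b) * (y b * z a)"
    by (simp add: u_def v_def power_add ac_simps)
  then show False using ab(3) by simp
qed

text \<open>Induction on \<open>k\<close>: the removed row differs from \<open>a\<close> and
  \<open>b\<close>, so the nonzero minor survives, and \<open>n\<close> and \<open>k\<close> drop
  together, which keeps the parity.\<close>

theorem completable_of_independent:
  fixes y z :: "nat \<Rightarrow> 'a :: field"
  assumes "4 \<le> k" "k \<le> n" "even (n + k)" "a < n" "b < n" "y a * z b \<noteq> y b * z a"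
  shows "completable n k y z"
  using assms
proof (induction k arbitrary: n a b y z rule: dec_induct)
  case base
  then have "n - 2 + 2 = n" "even (n - 2)" by auto
  then show ?case using completable_four[of "n - 2" a b y z] base.prems by simp
next
  case (step k)
  obtain m where n: "n = Suc m" using step.prems by (cases n) auto
  obtain i where i: "i < n" "i \<noteq> a" "i \<noteq> b"
    using exists_third_index[of n a b] step.prems step.hyps by auto
  have "completable m k (y \<circ> insert_index i) (z \<circ> insert_index i)"
    using step.prems step.hyps i n
    by (intro step.IH[of m "delete_index i a" "delete_index i b"])
      (auto simp: insert_delete_index_eq delete_index_less)
  then show ?case unfolding n using completable_Suc[of k i m y z] i n step.hyps by simp
qed

section \<open>Injective linear maps preserving rank one\<close>

text \<open>Gaussian elimination: a pivot vector \<open>p\<close> clears coordinate \<open>r\<close>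
  from the other vectors.\<close>

lemma exists_linear_dependency:
  fixes g :: "'i \<Rightarrow> 'r \<Rightarrow> 'a :: field"
  assumes "finite R" "finite I" "card R < card I"
  shows "\<exists>c. (\<exists>i\<in>I. c i \<noteq> 0) \<and> (\<forall>r\<in>R. (\<Sum>i\<in>I. c i * g i r) = 0)"
  using assms
proof (induction R arbitrary: I g rule: finite_induct)
  case empty
  then obtain i where "i \<in> I" by fastforce
  then show ?case by (intro exI[of _ "\<lambda>_. 1"]) auto
next
  case (insert r R)
  show ?case
  proof (cases "\<forall>i\<in>I. g i r = 0")
    case True
    have "card R < card I" using insert.prems insert.hyps by simp
    then obtain c where "\<exists>i\<in>I. c i \<noteq> 0" "\<forall>r\<in>R. (\<Sum>i\<in>I. c i * g i r) = 0"
      using insert.IH[OF insert.prems(1)] by blast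
    then show ?thesis using True by (intro exI[of _ c]) auto
  next
    case False
    then obtain p where p: "p \<in> I" "g p r \<noteq> 0" by blast
    let ?I = "I - {p}" and ?h = "\<lambda>i s. g i s - g i r / g p r * g p s"
    have "finite ?I" "card R < card ?I" using insert.prems insert.hyps p by auto
    then obtain c where c: "\<exists>i\<in>?I. c i \<noteq> 0" "\<forall>s\<in>R. (\<Sum>i\<in>?I. c i * ?h i s) = 0"
      using insert.IH[of ?I ?h] by blast
    \<comment> \<open>The pivot coefficient makes the combination of the original vectors equal to
      that of the reduced ones.\<close>
    define d where "d = c(p := - (\<Sum>i\<in>?I. c i * (g i r / g p r)))"
    have d: "(\<Sum>i\<in>I. d i * g i s) = (\<Sum>i\<in>?I. c i * ?h i s)" for s
    proof -
      have "(\<Sum>i\<in>I. d i * g i s) = d p * g p s + (\<Sum>i\<in>?I. d i * g i s)"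
        using insert.prems p by (simp add: sum.remove)
      also have "(\<Sum>i\<in>?I. d i * g i s) = (\<Sum>i\<in>?I. c i * g i s)"
        by (intro sum.cong) (auto simp: d_def)
      finally show ?thesis
        by (simp add: d_def right_diff_distrib sum_subtractf sum_distrib_right mult.assoc)
    qed
    have "(\<Sum>i\<in>I. d i * g i r) = 0" unfolding d using p by simp
    moreover have "\<exists>i\<in>I. d i \<noteq> 0" using c(1) by (auto simp: d_def)
    ultimately show ?thesis using c(2) d by (intro exI[of _ d]) auto
  qed
qed

definition delta :: "nat \<Rightarrow> nat \<Rightarrow> 'a :: zero_neq_one" where
  "delta a = (\<lambda>i. if i = a then 1 else 0)"

text \<open>A 2 x 2 minor of a sum of two rank-one matrices is the product of the minors of the
  column factors and of the row factors. It vanishes on a matrix of rank at most one, so one pair of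
  factors must be proportional.\<close>

lemma outer_mat_add_minors:
  fixes a b c d e f :: "nat \<Rightarrow> 'a :: comm_ring_1"
  assumes "outer_mat n k a b + outer_mat n k c d = outer_mat n k e f"
    and "i < n" "j < n" "l < k" "m < k"
  shows "(a i * c j - a j * c i) * (b l * d m - b m * d l) = 0"
proof -
  have e: "a i * b l + c i * d l = e i * f l" if "i < n" "l < k" for i l
    using arg_cong[OF assms(1), of "\<lambda>X. X $$ (i, l)"] that by simp
  have "(a i * c j - a j * c i) * (b l * d m - b m * d l) =
      (a i * b l + c i * d l) * (a j * b m + c j * d m) - (a i * b m + c i * d m) * (a j * b l + c j * d l)"
    by (simp add: algebra_simps)
  also have "\<dots> = 0" using assms by (simp add: e ac_simps)
  finally show ?thesis .
qed

lemma outer_mat_eq_zero_iff: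
  fixes x y :: "nat \<Rightarrow> 'a :: field"
  shows "outer_mat n k x y = 0\<^sub>m n k \<longleftrightarrow> (\<forall>i<n. x i = 0) \<or> (\<forall>j<k. y j = 0)"
proof
  assume *: "outer_mat n k x y = 0\<^sub>m n k"
  have "x i * y j = 0" if "i < n" "j < k" for i j
    using arg_cong[OF *, of "\<lambda>X. X $$ (i, j)"] that by simp
  then show "(\<forall>i<n. x i = 0) \<or> (\<forall>j<k. y j = 0)" by auto
qed (auto intro!: eq_matI)

lemma outer_mat_cong:
  assumes "\<And>i j. i < n \<Longrightarrow> j < k \<Longrightarrow> x i * y j = x' i * y' j"
  shows "outer_mat n k x y = outer_mat n k x' y'"
  using assms by (intro eq_matI) auto

section \<open>Linear maps on matrices\<close>

locale mat_linear =
  fixes n k :: nat and T :: "'a :: field mat \<Rightarrow> 'a mat"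
  assumes T_carrier [simp]: "X \<in> carrier_mat n k \<Longrightarrow> T X \<in> carrier_mat n k"
    and T_add: "X \<in> carrier_mat n k \<Longrightarrow> Y \<in> carrier_mat n k \<Longrightarrow> T (X + Y) = T X + T Y"
    and T_smult: "X \<in> carrier_mat n k \<Longrightarrow> T (c \<cdot>\<^sub>m X) = c \<cdot>\<^sub>m T X"
begin

lemma T_dim [simp]:
  assumes "X \<in> carrier_mat n k"
  shows "dim_row (T X) = n" "dim_col (T X) = k"
  using T_carrier[OF assms] by auto

lemma T_zero: "T (0\<^sub>m n k) = 0\<^sub>m n k"
proof -
  have "T (0 \<cdot>\<^sub>m 0\<^sub>m n k) = 0 \<cdot>\<^sub>m T (0\<^sub>m n k)" by (rule T_smult) simp
  moreover have "0 \<cdot>\<^sub>m X = 0\<^sub>m n k" if "X \<in> carrier_mat n k" for X :: "'a mat"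
    using that by (intro eq_matI) auto
  ultimately show ?thesis by simp
qed

lemma T_expand:
  assumes X: "X \<in> carrier_mat n k" and rs: "r < n" "s < k"
  shows "T X $$ (r, s) = (\<Sum>c<n. \<Sum>j<k. X $$ (c, j) * T (outer_mat n k (delta c) (delta j)) $$ (r, s))"
proof -
  let ?P = "{..<n} \<times> {..<k}"
  let ?E = "\<lambda>p. outer_mat n k (delta (fst p)) (delta (snd p)) :: 'a mat"
  let ?X = "\<lambda>S. mat n k (\<lambda>p. if p \<in> S then X $$ p else 0)"
  have "T (?X S) $$ (r, s) = (\<Sum>p\<in>S. X $$ p * T (?E p) $$ (r, s))" if "finite S" "S \<subseteq> ?P" for S
    using that
  proof (induction S rule: finite_induct)
    case empty
    have "?X {} = 0\<^sub>m n k" by (intro eq_matI) auto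
    then show ?case using rs by (simp add: T_zero)
  next
    case (insert p S)
    have "?X (insert p S) = ?X S + X $$ p \<cdot>\<^sub>m ?E p"
      using insert by (intro eq_matI) (auto simp: delta_def)
    then have "T (?X (insert p S)) = T (?X S) + X $$ p \<cdot>\<^sub>m T (?E p)" by (simp add: T_add T_smult)
    then have "T (?X (insert p S)) $$ (r, s) = T (?X S) $$ (r, s) + X $$ p * T (?E p) $$ (r, s)"
      using rs by simp
    then show ?case using insert by simp
  qed
  from this[of ?P] have "T (?X ?P) $$ (r, s) = (\<Sum>p\<in>?P. X $$ p * T (?E p) $$ (r, s))" by simp
  moreover have "?X ?P = X" using X by (intro eq_matI) auto
  ultimately show ?thesis by (simp add: sum.cartesian_product case_prod_unfold)
qed

lemma T_outer_expand:
  assumes rs: "r < n" "s < k"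
  shows "T (outer_mat n k x y) $$ (r, s) = (\<Sum>i<n. x i * T (outer_mat n k (delta i) y) $$ (r, s))"
proof -
  have "T (outer_mat n k (delta i) y) $$ (r, s) =
      (\<Sum>j<k. y j * T (outer_mat n k (delta i) (delta j)) $$ (r, s))" if "i < n" for i
  proof -
    have "T (outer_mat n k (delta i) y) $$ (r, s) =
        (\<Sum>c<n. if c = i then (\<Sum>j<k. y j * T (outer_mat n k (delta i) (delta j)) $$ (r, s)) else 0)"
      by (subst T_expand[OF _ rs], simp, rule sum.cong[OF refl]) (auto simp: delta_def)
    then show ?thesis using that by simp
  qed
  then show ?thesis
    by (subst T_expand[OF _ rs]) (auto simp: sum_distrib_left mult.assoc intro!: sum.cong)
qed

lemma T_outer_add:
  "T (outer_mat n k (\<lambda>i. x i + x' i) y) = T (outer_mat n k x y) + T (outer_mat n k x' y)"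
proof -
  have "outer_mat n k (\<lambda>i. x i + x' i) y = outer_mat n k x y + outer_mat n k x' y"
    by (intro eq_matI) (auto simp: algebra_simps)
  then show ?thesis by (simp add: T_add)
qed

end

locale injective_mat_linear = mat_linear +
  assumes T_injective: "X \<in> carrier_mat n k \<Longrightarrow> T X = 0\<^sub>m n k \<Longrightarrow> X = 0\<^sub>m n k"
begin

text \<open>Dimension count: the images of the \<open>n * k\<close> matrix units together with
  \<open>Z\<close>, indexed by \<open>None\<close>, are dependent, and injectivity forces a nonzero
  coefficient at \<open>Z\<close>.\<close>

lemma T_surjective:
  assumes Z: "Z \<in> carrier_mat n k"
  shows "\<exists>X \<in> carrier_mat n k. T X = Z"
proof -
  let ?P = "{..<n} \<times> {..<k}"
  let ?g = "\<lambda>q r. case q of None \<Rightarrow> Z $$ r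
    | Some p \<Rightarrow> T (outer_mat n k (delta (fst p)) (delta (snd p))) $$ r"
  let ?I = "insert None (Some ` ?P)"
  have "card ?P < card ?I" by (simp add: card_image)
  then obtain c where c: "\<exists>q\<in>?I. c q \<noteq> 0" "\<forall>r\<in>?P. (\<Sum>q\<in>?I. c q * ?g q r) = 0"
    using exists_linear_dependency[of ?P ?I ?g] by auto
  define X where "X = mat n k (\<lambda>p. c (Some p))"
  have X: "X \<in> carrier_mat n k" by (simp add: X_def)
  have TX: "T X $$ r + c None * Z $$ r = 0" if "r \<in> ?P" for r
  proof -
    have eq1: "T X $$ (fst r, snd r) =
        (\<Sum>p\<in>?P. c (Some p) * T (outer_mat n k (delta (fst p)) (delta (snd p))) $$ r)"
      using that by (subst T_expand[OF X]) (auto simp: X_def sum.cartesian_product case_prod_unfold intro!: sum.cong)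
    have eq2: "(\<Sum>q\<in>?I. c q * ?g q r) = c None * Z $$ r +
        (\<Sum>p\<in>?P. c (Some p) * T (outer_mat n k (delta (fst p)) (delta (snd p))) $$ r)"
      by (subst sum.insert) (auto simp: sum.reindex)
    have "T X $$ r + c None * Z $$ r = (\<Sum>q\<in>?I. c q * ?g q r)"
      unfolding eq2 using eq1 by simp
    also have "\<dots> = 0" using c(2) that by blast
    finally show ?thesis .
  qed
  have "c None \<noteq> 0"
  proof
    assume 0: "c None = 0"
    have "T X = 0\<^sub>m n k"
      using TX X 0 by (intro eq_matI) auto
    then have X0: "X = 0\<^sub>m n k" by (rule T_injective[OF X])
    have "c (Some (i, j)) = 0" if "i < n" "j < k" for i j
      using arg_cong[OF X0, of "\<lambda>X. X $$ (i, j)"] that by (simp add: X_def)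
    then show False using c(1) 0 by auto
  qed
  then have "T ((- 1 / c None) \<cdot>\<^sub>m X) = Z"
    unfolding T_smult[OF X] using TX X Z
    by (intro eq_matI) (auto simp: field_simps neg_eq_iff_add_eq_0)
  then show ?thesis using X by (intro bexI[of _ "(- 1 / c None) \<cdot>\<^sub>m X"]) auto
qed

end

section \<open>From preservation of rank one to two-sided products\<close>

locale rank_one_preserver = injective_mat_linear +
  assumes k_pos: "0 < k" and k_less: "k < n"
    and T_rank_one: "\<exists>x' y'. T (outer_mat n k x y) = outer_mat n k x' y'"
begin

lemma T_outer_nonzero:
  assumes "i < n" "x i \<noteq> 0" "j < k" "y j \<noteq> 0"
  shows "T (outer_mat n k x y) \<noteq> 0\<^sub>m n k"
  using T_injective[of "outer_mat n k x y"] assms by (auto simp: outer_mat_eq_zero_iff)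

text \<open>The image of \<open>{outer_mat n k x y | x. True}\<close> is an \<open>n\<close>-dimensional space of matrices of rank at
  most one. The elements of such a space share their column factor or their row factor; in the first
  case the dimension would be at most \<open>k < n\<close>.\<close>

lemma T_common_row:
  assumes y: "l < k" "y l \<noteq> 0"
  shows "\<exists>y'. (\<exists>l<k. y' l \<noteq> 0) \<and> (\<forall>x. \<exists>x'. T (outer_mat n k x y) = outer_mat n k x' y')"
proof -
  have n: "0 < n" using k_less by simp
  obtain x0 y0 where xy0: "T (outer_mat n k (delta 0) y) = outer_mat n k x0 y0" using T_rank_one by blast
  then obtain i0 l0 where nz: "i0 < n" "x0 i0 \<noteq> 0" "l0 < k" "y0 l0 \<noteq> 0"
    using T_outer_nonzero[of 0 "delta 0" l y] n y by (auto simp: outer_mat_eq_zero_iff delta_def)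
  have "\<exists>x'. T (outer_mat n k x y) = outer_mat n k x' y0" for x
  proof (rule ccontr)
    assume no: "\<nexists>x'. T (outer_mat n k x y) = outer_mat n k x' y0"
    obtain x1 y1 where xy1: "T (outer_mat n k x y) = outer_mat n k x1 y1" using T_rank_one by blast
    \<comment> \<open>If \<open>y1\<close> were a multiple of \<open>y0\<close>, the scalar could be
      moved into the column factor.\<close>
    have "\<exists>l<k. y0 l0 * y1 l \<noteq> y0 l * y1 l0"
    proof (rule ccontr)
      assume "\<not> ?thesis"
      then have "outer_mat n k x1 y1 = outer_mat n k (\<lambda>i. x1 i * (y1 l0 / y0 l0)) y0"
        using nz by (intro outer_mat_cong) (auto simp: field_simps)
      then show False using no xy1 by auto
    qed
    then obtain l1 where l1: "l1 < k" "y0 l0 * y1 l1 \<noteq> y0 l1 * y1 l0" by blast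
    \<comment> \<open>The row factors are independent, so the column factors are
      proportional.\<close>
    have mult: "x1 i = x1 i0 / x0 i0 * x0 i" if "i < n" for i
    proof -
      obtain e f where "outer_mat n k x0 y0 + outer_mat n k x1 y1 = outer_mat n k e f"
        using T_rank_one[of "\<lambda>i. delta 0 i + x i" y] unfolding T_outer_add xy0 xy1 by blast
      from outer_mat_add_minors[OF this nz(1) that nz(3) l1(1)]
      have "x0 i0 * x1 i - x0 i * x1 i0 = 0" using l1 by simp
      then show ?thesis using nz by (simp add: field_simps)
    qed
    have x1: "x1 i0 \<noteq> 0"
    proof
      assume "x1 i0 = 0"
      then have "outer_mat n k x1 y1 = outer_mat n k (\<lambda>_. 0) y0"
        using mult by (intro outer_mat_cong) auto
      then show False using no xy1 by auto
    qed
    \<comment> \<open>A column factor independent of \<open>x0\<close>, hence of \<open>x1\<close>,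
      would make \<open>z\<close> proportional to both \<open>y0\<close> and \<open>y1\<close>, so
      \<open>z\<close> would vanish.\<close>
    have "\<exists>z. T (outer_mat n k w y) = outer_mat n k x0 z" for w
    proof -
      obtain v z where vz: "T (outer_mat n k w y) = outer_mat n k v z" using T_rank_one by blast
      show ?thesis
      proof (cases "\<forall>i<n. x0 i0 * v i = x0 i * v i0")
        case True
        then have "outer_mat n k v z = outer_mat n k x0 (\<lambda>l. v i0 / x0 i0 * z l)"
          using nz by (intro outer_mat_cong) (auto simp: field_simps)
        then show ?thesis using vz by auto
      next
        case False
        then obtain i where i: "i < n" "x0 i0 * v i \<noteq> x0 i * v i0" by blast
        obtain e f where "outer_mat n k x0 y0 + outer_mat n k v z = outer_mat n k e f"
          using T_rank_one[of "\<lambda>i. delta 0 i + w i" y] unfolding T_outer_add xy0 vz by blast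
        from outer_mat_add_minors[OF this nz(1) i(1)] i(2)
        have z0: "y0 a * z b = y0 b * z a" if "a < k" "b < k" for a b using that by fastforce
        obtain e f where "outer_mat n k x1 y1 + outer_mat n k v z = outer_mat n k e f"
          using T_rank_one[of "\<lambda>i. x i + w i" y] unfolding T_outer_add xy1 vz by blast
        note ef = outer_mat_add_minors[OF this nz(1) i(1)]
        have "x1 i0 * v i - x1 i * v i0 = x1 i0 / x0 i0 * (x0 i0 * v i - x0 i * v i0)"
          using nz mult[OF i(1)] by (simp add: field_simps)
        then have "x1 i0 * v i - x1 i * v i0 \<noteq> 0" using x1 nz i(2) by simp
        then have z1: "y1 a * z b = y1 b * z a" if "a < k" "b < k" for a b using ef[OF that] by simp
        have "z l = 0" if l: "l < k" for l
        proof -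
          have "(y0 l0 * y1 l1 - y0 l1 * y1 l0) * z l = y1 l1 * (y0 l0 * z l) - y1 l0 * (y0 l1 * z l)"
            by (simp add: algebra_simps)
          also have "\<dots> = y0 l * (y1 l1 * z l0 - y1 l0 * z l1)"
            unfolding z0[OF nz(3) l] z0[OF l1(1) l] by (simp add: algebra_simps)
          also have "\<dots> = 0" using z1[OF nz(3) l1(1)] by simp
          finally show ?thesis using l1 by simp
        qed
        then have "outer_mat n k v z = outer_mat n k x0 (\<lambda>_. 0)" by (intro outer_mat_cong) auto
        then show ?thesis using vz by auto
      qed
    qed
    then have "\<forall>i. \<exists>z. T (outer_mat n k (delta i) y) = outer_mat n k x0 z" by blast
    from choice[OF this] obtain z where z: "\<And>i. T (outer_mat n k (delta i) y) = outer_mat n k x0 (z i)"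
      by blast
    \<comment> \<open>There are \<open>n\<close> row factors with only \<open>k < n\<close> entries;
      a dependency among them gives a nonzero matrix with image zero.\<close>
    obtain c where c: "\<exists>i<n. c i \<noteq> 0" "\<forall>s<k. (\<Sum>i<n. c i * z i s) = 0"
      using exists_linear_dependency[of "{..<k}" "{..<n}" z] k_less by auto
    have "T (outer_mat n k c y) = 0\<^sub>m n k"
    proof (rule eq_matI)
      fix r s assume "r < dim_row (0\<^sub>m n k :: 'a mat)" "s < dim_col (0\<^sub>m n k :: 'a mat)"
      then have rs: "r < n" "s < k" by auto
      have "T (outer_mat n k c y) $$ (r, s) = x0 r * (\<Sum>i<n. c i * z i s)"
        using rs by (simp add: T_outer_expand z sum_distrib_left ac_simps)
      then show "T (outer_mat n k c y) $$ (r, s) = 0\<^sub>m n k $$ (r, s)" using rs c(2) by simp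
    qed auto
    then show False using c(1) T_outer_nonzero y by blast
  qed
  then show ?thesis using nz by blast
qed

text \<open>Matrices supported in column \<open>j\<close> have images with common row factor
  \<open>b j\<close>. Once all column maps \<open>a j\<close> are multiples \<open>g j\<close> of
  \<open>a 0\<close>, the matrix of \<open>a 0\<close> serves as \<open>A\<close> and the rows
  \<open>g j * b j\<close> form \<open>B\<close>.\<close>

theorem T_two_sided_product:
  "\<exists>A \<in> carrier_mat n n. \<exists>B \<in> carrier_mat k k. \<forall>X \<in> carrier_mat n k. T X = A * X * B"
proof -
  have n: "0 < n" using k_less by simp
  have "\<exists>y'. (\<exists>l<k. y' l \<noteq> 0) \<and> (\<forall>x. \<exists>x'. T (outer_mat n k x (delta j)) = outer_mat n k x' y')"
    if "j < k" for j using T_common_row[of j "delta j"] that by (simp add: delta_def)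
  then obtain b where b: "\<And>j. j < k \<Longrightarrow> \<exists>l<k. b j l \<noteq> 0"
    "\<And>j x. j < k \<Longrightarrow> \<exists>x'. T (outer_mat n k x (delta j)) = outer_mat n k x' (b j)" by metis
  from b(2) obtain a where a: "\<And>j x. j < k \<Longrightarrow> T (outer_mat n k x (delta j)) = outer_mat n k (a j x) (b j)"
    by metis
  have multiple: "\<exists>g. \<forall>x. \<forall>i<n. a j x i = g * a 0 x i" if j: "j < k" "j \<noteq> 0" for j
  proof -
    have "\<exists>p<k. \<exists>q<k. b 0 p * b j q \<noteq> b 0 q * b j p"
    proof (rule ccontr)
      assume no: "\<not> ?thesis"
      obtain p where p: "p < k" "b 0 p \<noteq> 0" using b(1)[OF k_pos] by blast
      define g where "g = b j p / b 0 p"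
      have bj: "b j l = g * b 0 l" if "l < k" for l
        using no p that by (auto simp: g_def field_simps)
      \<comment> \<open>If \<open>b j\<close> were a multiple of \<open>b 0\<close>, the column
        vectors from column 0 and one more from column \<open>j\<close>, at index \<open>n\<close>,
        would be \<open>n + 1\<close> vectors of length \<open>n\<close>. Their dependency yields a
        nonzero matrix in the kernel.\<close>
      obtain c where c: "\<exists>i\<le>n. c i \<noteq> 0"
        "\<forall>r<n. (\<Sum>i\<le>n. c i * (if i < n then a 0 (delta i) r else g * a j (delta 0) r)) = 0"
        using exists_linear_dependency[of "{..<n}" "{..n}"
            "\<lambda>i r. if i < n then a 0 (delta i) r else g * a j (delta 0) r"] by auto
      let ?X = "outer_mat n k c (delta 0) + c n \<cdot>\<^sub>m outer_mat n k (delta 0) (delta j)"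
      have "T ?X = 0\<^sub>m n k"
      proof (rule eq_matI)
        fix r s assume "r < dim_row (0\<^sub>m n k :: 'a mat)" "s < dim_col (0\<^sub>m n k :: 'a mat)"
        then have rs: "r < n" "s < k" by auto
        have "T ?X $$ (r, s) = T (outer_mat n k c (delta 0)) $$ (r, s) +
            c n * T (outer_mat n k (delta 0) (delta j)) $$ (r, s)"
          using rs by (simp add: T_add T_smult)
        also have "T (outer_mat n k c (delta 0)) $$ (r, s) = b 0 s * (\<Sum>i<n. c i * a 0 (delta i) r)"
          using rs k_pos by (subst T_outer_expand[OF rs]) (simp add: a sum_distrib_left ac_simps)
        also have "c n * T (outer_mat n k (delta 0) (delta j)) $$ (r, s) = b 0 s * (c n * (g * a j (delta 0) r))"
          using rs j by (simp add: a bj)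
        also have "b 0 s * (\<Sum>i<n. c i * a 0 (delta i) r) + b 0 s * (c n * (g * a j (delta 0) r)) =
            b 0 s * (\<Sum>i\<le>n. c i * (if i < n then a 0 (delta i) r else g * a j (delta 0) r))"
          by (simp add: lessThan_Suc_atMost[symmetric] distrib_left)
        finally show "T ?X $$ (r, s) = 0\<^sub>m n k $$ (r, s)" using rs c(2) by simp
      qed auto
      then have X0: "?X = 0\<^sub>m n k" by (rule T_injective[rotated]) simp
      have "c i = 0" if "i < n" for i
        using arg_cong[OF X0, of "\<lambda>X. X $$ (i, 0)"] that k_pos j by (simp add: delta_def)
      moreover have "c n = 0"
        using arg_cong[OF X0, of "\<lambda>X. X $$ (0, j)"] n j by (simp add: delta_def)
      ultimately show False using c(1) by (metis le_neq_implies_less)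
    qed
    then obtain p q where pq: "p < k" "q < k" "b 0 p * b j q - b 0 q * b j p \<noteq> 0" by auto
    let ?d = "b 0 p * b j q - b 0 q * b j p"
    \<comment> \<open>The row vector \<open>delta 0 + delta j\<close> also has a common row factor
      \<open>e\<close>, which couples \<open>a j\<close> to \<open>a 0\<close>.\<close>
    obtain e where "\<forall>x. \<exists>x'. T (outer_mat n k x (\<lambda>i. delta 0 i + delta j i)) = outer_mat n k x' e"
      using T_common_row[of 0 "\<lambda>i. delta 0 i + delta j i"] k_pos j by (auto simp: delta_def)
    then obtain d where d: "\<And>x. T (outer_mat n k x (\<lambda>i. delta 0 i + delta j i)) = outer_mat n k (d x) e"
      by metis
    have sum: "d x i * e l = a 0 x i * b 0 l + a j x i * b j l" if "i < n" "l < k" for x i l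
    proof -
      have "outer_mat n k x (\<lambda>i. delta 0 i + delta j i) = outer_mat n k x (delta 0) + outer_mat n k x (delta j)"
        by (intro eq_matI) (auto simp: algebra_simps)
      then have "outer_mat n k (d x) e = outer_mat n k (a 0 x) (b 0) + outer_mat n k (a j x) (b j)"
        using d[of x] a[OF k_pos] a[OF j(1)] by (simp add: T_add)
      from arg_cong[OF this, of "\<lambda>X. X $$ (i, l)"] that show ?thesis by simp
    qed
    \<comment> \<open>Cramer's rule for \<open>sum\<close> in columns \<open>p\<close> and
      \<open>q\<close>, with determinant \<open>?d\<close>.\<close>
    define s t where "s = e p * b j q - e q * b j p" and "t = b 0 p * e q - b 0 q * e p"
    have st: "a 0 x i * ?d = d x i * s" "a j x i * ?d = d x i * t" if "i < n" for x i
    proof -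
      have "d x i * s = (d x i * e p) * b j q - (d x i * e q) * b j p"
        "d x i * t = b 0 p * (d x i * e q) - b 0 q * (d x i * e p)"
        by (simp_all add: s_def t_def algebra_simps)
      then show "a 0 x i * ?d = d x i * s" "a j x i * ?d = d x i * t"
        unfolding sum[OF that pq(1)] sum[OF that pq(2)] by (simp_all add: algebra_simps)
    qed
    have "s \<noteq> 0"
    proof
      assume "s = 0"
      then have "a 0 (delta 0) i = 0" if "i < n" for i using st(1)[OF that] pq by simp
      then have "T (outer_mat n k (delta 0) (delta 0)) = 0\<^sub>m n k"
        unfolding a[OF k_pos] outer_mat_eq_zero_iff by blast
      then show False using T_outer_nonzero[of 0 "delta 0" 0 "delta 0"] n k_pos by (auto simp: delta_def)
    qed
    have "a j x i = t / s * a 0 x i" if "i < n" for x i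
    proof -
      have "(a j x i * s) * ?d = (a j x i * ?d) * s" by (simp only: ac_simps)
      also have "\<dots> = t * (a 0 x i * ?d)" unfolding st[OF that, of x] by (simp only: ac_simps)
      finally have "a j x i * s = t * a 0 x i" using pq(3) by (simp only: mult.assoc[symmetric] mult_cancel_right simp_thms)
      then show ?thesis using \<open>s \<noteq> 0\<close> by (simp add: field_simps)
    qed
    then show ?thesis by blast
  qed
  have "\<exists>g. \<forall>x. \<forall>i<n. a j x i = g * a 0 x i" if "j < k" for j
    using multiple[OF that] by (cases "j = 0") (auto intro: exI[of _ 1])
  then obtain g where g: "\<And>j x i. j < k \<Longrightarrow> i < n \<Longrightarrow> a j x i = g j * a 0 x i" by metis
  define A where "A = mat n n (\<lambda>(r, c). a 0 (delta c) r)"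
  define B where "B = mat k k (\<lambda>(j, s). g j * b j s)"
  have "T X = A * X * B" if X: "X \<in> carrier_mat n k" for X
  proof (rule eq_matI)
    fix r s assume "r < dim_row (A * X * B)" "s < dim_col (A * X * B)"
    then have rs: "r < n" "s < k" by (auto simp: A_def B_def)
    have "T X $$ (r, s) = (\<Sum>c<n. \<Sum>j<k. X $$ (c, j) * T (outer_mat n k (delta c) (delta j)) $$ (r, s))"
      by (rule T_expand[OF X rs])
    also have "\<dots> = (\<Sum>c<n. \<Sum>j<k. A $$ (r, c) * X $$ (c, j) * B $$ (j, s))"
    proof (intro sum.cong refl)
      fix c j assume cj: "c \<in> {..<n}" "j \<in> {..<k}"
      then have "T (outer_mat n k (delta c) (delta j)) $$ (r, s) = a j (delta c) r * b j s"
        using rs by (simp add: a)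
      also have "\<dots> = A $$ (r, c) * B $$ (j, s)"
        by (subst g) (use cj rs in \<open>simp_all add: A_def B_def ac_simps\<close>)
      finally show "X $$ (c, j) * T (outer_mat n k (delta c) (delta j)) $$ (r, s) =
          A $$ (r, c) * X $$ (c, j) * B $$ (j, s)" by (simp add: ac_simps)
    qed
    also have "\<dots> = (\<Sum>j<k. (\<Sum>c<n. A $$ (r, c) * X $$ (c, j)) * B $$ (j, s))"
      by (subst sum.swap) (simp add: sum_distrib_right)
    also have "\<dots> = (A * X * B) $$ (r, s)"
      using rs X by (simp add: A_def B_def scalar_prod_def lessThan_atLeast0)
    finally show "T X $$ (r, s) = (A * X * B) $$ (r, s)" .
  qed (use X in \<open>auto simp: A_def B_def\<close>)
  then show ?thesis by (intro bexI[of _ A] bexI[of _ B]) (auto simp: A_def B_def)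
qed

end

section \<open>Preservers of the Cullis determinant\<close>

text \<open>If all minors vanish, a nonzero entry at \<open>(a, p)\<close> exhibits \<open>W\<close>
  as the product of column \<open>p\<close> and row \<open>a\<close> divided by that entry.\<close>

lemma exists_minor_of_not_outer:
  fixes W :: "'a :: field mat"
  assumes W: "W \<in> carrier_mat n k" and no: "\<nexists>x y. W = outer_mat n k x y"
  shows "\<exists>a b p q. a < n \<and> b < n \<and> p < k \<and> q < k \<and> W $$ (a, p) * W $$ (b, q) \<noteq> W $$ (b, p) * W $$ (a, q)"
proof (rule ccontr)
  assume "\<not> ?thesis"
  then have minors: "W $$ (a, p) * W $$ (b, q) = W $$ (b, p) * W $$ (a, q)"
    if "a < n" "b < n" "p < k" "q < k" for a b p q using that by blast
  show False
  proof (cases "\<exists>a<n. \<exists>p<k. W $$ (a, p) \<noteq> 0")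
    case True
    then obtain a p where ap: "a < n" "p < k" "W $$ (a, p) \<noteq> 0" by blast
    have "W = outer_mat n k (\<lambda>i. W $$ (i, p)) (\<lambda>j. W $$ (a, j) / W $$ (a, p))"
      using W ap minors[OF ap(1) _ ap(2)] by (intro eq_matI) (auto simp: field_simps)
    then show False using no by blast
  next
    case False
    then have "W = outer_mat n k (\<lambda>_. 0) (\<lambda>_. 0)" using W by (intro eq_matI) auto
    then show False using no by blast
  qed
qed

locale cullis_preserver = mat_linear n k T for n k and T :: "'a :: field mat \<Rightarrow> 'a mat" +
  assumes k_ge: "4 \<le> k" and k_less_n: "k < n" and parity: "even (n + k)"
    and field_size: "infinite (UNIV :: 'a set) \<or> card (UNIV :: 'a set) > k"
    and preserves: "X \<in> carrier_mat n k \<Longrightarrow> cullis_det (T X) = cullis_det X"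
begin

lemma exists_completion:
  fixes y z :: "nat \<Rightarrow> 'a"
  assumes "a < n" "b < n" "p < k" "q < k" "p \<noteq> q" "y a * z b \<noteq> y b * z a"
  shows "\<exists>X \<in> carrier_mat n k. (\<forall>i<n. X $$ (i, p) = y i \<and> X $$ (i, q) = z i) \<and> cullis_det X \<noteq> 0"
proof -
  have "completable n k y z"
    by (rule completable_of_independent[OF k_ge _ parity]) (use assms k_less_n in auto)
  then show ?thesis using assms unfolding completable_def by blast
qed

text \<open>Subtracting an element \<open>Y\<close> of the kernel does not change the determinant.
  If \<open>X\<close> shares a nonzero column with \<open>Y\<close>, the difference has a zero
  column, although \<open>X\<close> can be chosen with nonzero determinant.\<close>

lemma kernel_trivial:
  assumes Y: "Y \<in> carrier_mat n k" and TY: "T Y = 0\<^sub>m n k"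
  shows "Y = 0\<^sub>m n k"
proof (rule ccontr)
  assume "Y \<noteq> 0\<^sub>m n k"
  then obtain a p where ap: "a < n" "p < k" "Y $$ (a, p) \<noteq> 0"
    using Y by (metis carrier_matD eq_matI index_zero_mat)
  \<comment> \<open>With \<open>b\<close> other than \<open>a\<close>, the unit vector
    \<open>delta b\<close> is independent of column \<open>p\<close> of \<open>Y\<close>.\<close>
  obtain b where b: "b < n" "b \<noteq> a" using exists_third_index[of n a a] k_ge k_less_n by auto
  obtain q where q: "q < k" "q \<noteq> p" using exists_third_index[of k p p] k_ge by auto
  obtain X where X: "X \<in> carrier_mat n k" "\<And>i. i < n \<Longrightarrow> X $$ (i, p) = Y $$ (i, p)" "cullis_det X \<noteq> 0"
    using exists_completion[of a b p q "\<lambda>i. Y $$ (i, p)" "delta b"] ap b q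
    by (auto simp: delta_def)
  let ?Z = "X + (- 1) \<cdot>\<^sub>m Y"
  have "?Z + Y = X" using X(1) Y by (intro eq_matI) auto
  moreover have "T (?Z + Y) = T ?Z"
    using X(1) Y TY T_add[of ?Z Y] T_carrier[of ?Z] by simp
  ultimately have "cullis_det X = cullis_det ?Z"
    using preserves[of X] preserves[of ?Z] X(1) Y by simp
  also have "\<dots> = 0"
    using X(1,2) Y ap by (intro cullis_det_col_zero[of _ n k p]) auto
  finally show False using X(3) by simp
qed

sublocale injective_mat_linear n k T
  by unfold_locales (rule kernel_trivial)

text \<open>If \<open>Y\<close> has rank one, then \<open>cullis_det (X + c Y)\<close> is affine in \<open>c\<close>. If \<open>T Y\<close> had two
  independent columns, then for a suitable \<open>Z = T X\<close> vanishing in these two columns,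
  \<open>cullis_det (Z + c (T Y))\<close> would be a polynomial in \<open>c\<close> of degree at most \<open>k\<close> with nonzero
  coefficient at \<open>c\<^sup>2\<close>.\<close>

lemma preserves_rank_one: "\<exists>x' y'. T (outer_mat n k x y) = outer_mat n k x' y'"
proof (rule ccontr)
  let ?Y = "outer_mat n k x y"
  define W where "W = T ?Y"
  have W: "W \<in> carrier_mat n k" by (simp add: W_def)
  assume "\<not> ?thesis"
  then have "\<nexists>x y. W = outer_mat n k x y" by (simp add: W_def)
  from exists_minor_of_not_outer[OF W this] obtain a b p q where minor: "a < n" "b < n" "p < k" "q < k"
    "W $$ (a, p) * W $$ (b, q) \<noteq> W $$ (b, p) * W $$ (a, q)" by blast
  then have pq: "p \<noteq> q" by auto
  obtain X0 where X0: "X0 \<in> carrier_mat n k" "cullis_det X0 \<noteq> 0"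
    "\<And>i. i < n \<Longrightarrow> X0 $$ (i, p) = W $$ (i, p)" "\<And>i. i < n \<Longrightarrow> X0 $$ (i, q) = W $$ (i, q)"
    using exists_completion[of a b p q "\<lambda>i. W $$ (i, p)" "\<lambda>i. W $$ (i, q)"] minor pq by blast
  define Z where "Z = mat n k (\<lambda>(i, j). if j = p \<or> j = q then 0 else X0 $$ (i, j))"
  have Z: "Z \<in> carrier_mat n k" by (simp add: Z_def)
  obtain X where X: "X \<in> carrier_mat n k" "T X = Z" using T_surjective[OF Z] by blast
  obtain \<alpha> \<beta> where affine: "\<And>c. cullis_det (X + c \<cdot>\<^sub>m ?Y) = \<alpha> + c * \<beta>"
    using cullis_det_rank_one_update[OF X(1)] by blast
  have fZ: "cullis_det (Z + c \<cdot>\<^sub>m W) = \<alpha> + c * \<beta>" for c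
  proof -
    have "T (X + c \<cdot>\<^sub>m ?Y) = Z + c \<cdot>\<^sub>m W"
      using X by (simp add: T_add T_smult W_def)
    then show ?thesis using preserves[of "X + c \<cdot>\<^sub>m ?Y"] X(1) affine by simp
  qed
  \<comment> \<open>\<open>M\<close> is \<open>Z\<close> plus \<open>c\<close> times
    \<open>W\<close> with the factor \<open>c\<close> taken out of columns \<open>p\<close> and
    \<open>q\<close>. These become constant, so the degree is at most \<open>k - 2\<close>, and
    \<open>c = 0\<close> gives back \<open>X0\<close>.\<close>
  define M where "M = (\<lambda>i j. if j = p \<or> j = q then [:W $$ (i, j):] else [:X0 $$ (i, j), W $$ (i, j):])"
  define d where "d = (\<lambda>j. if j = p \<or> j = q then 0 else 1 :: nat)"
  have "degree (M i j) \<le> d j" for i j by (auto simp: M_def d_def)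
  then obtain Q where Q: "degree Q \<le> (\<Sum>j<k. d j)"
    "\<And>c. poly Q c = cullis_det (mat n k (\<lambda>(i, j). poly (M i j) c))"
    using cullis_det_poly[of n k M d] by blast
  have "(\<Sum>j<k. d j) = card ({..<k} - {p, q})"
    unfolding d_def card_eq_sum by (intro sum.mono_neutral_cong_right) auto
  also have "\<dots> = k - 2" using minor pq by (subst card_Diff_subset) auto
  finally have degQ: "degree Q \<le> k - 2" using Q(1) by simp
  have scale: "cullis_det (Z + c \<cdot>\<^sub>m W) = c * (c * poly Q c)" for c
  proof -
    let ?U = "mat n k (\<lambda>(i, j). if j = q then c * W $$ (i, q) else poly (M i j) c)"
    have "cullis_det (Z + c \<cdot>\<^sub>m W) = c * cullis_det ?U"
      by (rule cullis_det_col_scale[of _ n k _ p]) (use W Z minor pq in \<open>auto simp: Z_def M_def\<close>)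
    also have "cullis_det ?U = c * poly Q c"
      unfolding Q(2)
      by (rule cullis_det_col_scale[of _ n k _ q]) (use minor pq in \<open>auto simp: M_def\<close>)
    finally show ?thesis .
  qed
  \<comment> \<open>\<open>?R\<close> vanishes everywhere and has degree at most \<open>k\<close>,
    so it is zero. Its coefficient at degree 2 is \<open>poly Q 0\<close>, the determinant of
    \<open>X0\<close>.\<close>
  let ?R = "pCons 0 (pCons 0 Q) - [:\<alpha>, \<beta>:]"
  have roots: "poly ?R c = 0" for c
    using fZ[of c] scale[of c] by (simp add: algebra_simps)
  have "degree (pCons 0 (pCons 0 Q)) \<le> k"
    using degQ k_ge degree_pCons_le[of 0 "pCons 0 Q"] degree_pCons_le[of 0 Q] by linarith
  then have degR: "degree ?R \<le> k"
    using k_ge by (intro degree_diff_le) auto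
  have "?R = 0"
  proof (rule ccontr)
    assume R: "?R \<noteq> 0"
    have "{c. poly ?R c = 0} = UNIV" using roots by auto
    then have "finite (UNIV :: 'a set)" "card (UNIV :: 'a set) \<le> degree ?R"
      using poly_roots_finite[OF R] card_poly_roots_bound[OF R] by auto
    then show False using degR field_size by simp
  qed
  then have "coeff ?R 2 = 0" by simp
  then have "poly Q 0 = 0" by (simp add: numeral_2_eq_2 poly_0_coeff_0)
  moreover have "mat n k (\<lambda>(i, j). poly (M i j) 0) = X0"
    using X0 by (intro eq_matI) (auto simp: M_def)
  ultimately show False using Q(2)[of 0] X0(2) by simp
qed

sublocale rank_one_preserver n k T
  using k_ge k_less_n preserves_rank_one by unfold_locales auto

end

section \<open>Matrices of unit columns and left multiplication\<close>

definition unit_cols :: "nat \<Rightarrow> nat \<Rightarrow> (nat \<Rightarrow> nat) \<Rightarrow> 'a :: zero_neq_one mat" where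
  "unit_cols n k c = mat n k (\<lambda>(i, j). if i = c j then 1 else 0)"

lemma unit_cols_carrier [simp]: "unit_cols n k c \<in> carrier_mat n k"
  by (simp add: unit_cols_def)

text \<open>The minor on the rows \<open>J\<close> is the identity; any other index set contains a
  row outside \<open>J\<close>, which is zero.\<close>

lemma cullis_det_unit_cols_pick:
  assumes J: "J \<subseteq> {..<n}" "card J = k"
  shows "cullis_det (unit_cols n k (pick J) :: 'a :: comm_ring_1 mat) = (- 1) ^ (\<Sum>J + \<Sum>{..<k})"
proof -
  let ?E = "unit_cols n k (pick J) :: 'a mat" and ?P = "{K. K \<subseteq> {..<n} \<and> card K = k}"
  have finJ: "finite J" using J finite_subset by auto
  have "det (submatrix ?E K UNIV) = (if K = J then 1 else 0)" if K: "K \<in> ?P" for K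
  proof (cases "K = J")
    case True
    have "pick J a = pick J b \<longleftrightarrow> a = b" if "a < k" "b < k" for a b
      using that bij_betw_pick[OF finJ] J(2) by (auto simp: bij_betw_def inj_on_eq_iff)
    moreover have "pick J a < n" if "a < k" for a using pick_in_set_le[of a J] that J by auto
    ultimately have "submatrix ?E K UNIV = 1\<^sub>m k"
      unfolding True using J by (subst submatrix_rows[of _ n k]) (auto simp: unit_cols_def intro!: eq_matI)
    then show ?thesis using True by simp
  next
    case False
    have "\<not> K \<subseteq> J" using card_subset_eq[OF finJ, of K] False K J by auto
    then obtain r where r: "r \<in> K" "r \<notin> J" by auto
    have "r \<in> pick K ` {..<card K}"
      using pick_image[of K] r K finite_subset[of K "{..<n}"] by auto
    then obtain t where t: "t < k" "pick K t = r" using K by auto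
    have S: "submatrix ?E K UNIV \<in> carrier_mat k k" using K by (subst submatrix_rows[of _ n k]) auto
    have "r < n" using r K by auto
    then have "submatrix ?E K UNIV $$ (t, j) = 0" if "j < k" for j
      using that t K r pick_in_set_le[of j J] J
      by (subst submatrix_rows[of _ n k]) (auto simp: unit_cols_def)
    then have "det (submatrix ?E K UNIV) = 0"
      unfolding laplace_expansion_row[OF S t(1)] by simp
    then show ?thesis using False by simp
  qed
  then have "cullis_det ?E = (\<Sum>K\<in>?P. if K = J then (- 1) ^ (\<Sum>J + \<Sum>{..<k}) else 0)"
    unfolding cullis_det_alt[OF unit_cols_carrier] by (intro sum.cong) auto
  then show ?thesis using J by simp
qed

text \<open>The exponent on the left has indices starting at 1. Each index is at least its position,
  so the subtraction is not truncated.\<close>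

lemma cullis_sign_alt:
  assumes "finite J" "card J = k"
  shows "(- 1 :: 'a :: comm_ring_1) ^ ((\<Sum>j\<in>J. j + 1) - (\<Sum>a=1..k. a)) = (- 1) ^ (\<Sum>J + \<Sum>{..<k})"
proof -
  have "(\<Sum>j\<in>J. j + 1) = (\<Sum>a<k. pick J a + 1)"
    using sum_pick[OF assms(1), of "\<lambda>j. j + 1"] assms(2) by simp
  also have "\<dots> = (\<Sum>a<k. (pick J a - a) + (a + 1))"
    using le_pick[of _ J] assms(2) by (intro sum.cong) auto
  also have "\<dots> = (\<Sum>a<k. pick J a - a) + (\<Sum>a<k. a + 1)" by (rule sum.distrib)
  also have "(\<Sum>a<k. a + 1) = (\<Sum>a=1..k. a)"
    by (rule sum.reindex_bij_witness[of _ "\<lambda>a. a - 1" Suc]) auto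
  finally show ?thesis using pick_sign[OF assms] by simp
qed

text \<open>This reads the condition on \<open>A\<close> and \<open>B\<close> as invariance of the
  determinant on increasing unit columns.\<close>

lemma cullis_det_unit_cols:
  assumes "J \<subseteq> {..<n}" "card J = k"
  shows "(- 1) ^ ((\<Sum>j\<in>J. j + 1) - (\<Sum>a=1..k. a)) =
    cullis_det (unit_cols n k (pick J) :: 'a :: comm_ring_1 mat)"
  using assms
  by (simp only: cullis_det_unit_cols_pick cullis_sign_alt finite_subset[OF _ finite_lessThan])

lemma mult_unit_cols_pick:
  fixes A :: "'a :: comm_ring_1 mat"
  assumes A: "A \<in> carrier_mat n n" and J: "J \<subseteq> {..<n}" "card J = k"
  shows "A * unit_cols n k (pick J) = submatrix A UNIV J"
proof -
  have "{j. j < n \<and> j \<in> J} = J" using J by auto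
  then have S: "submatrix A UNIV J = mat n k (\<lambda>(a, b). A $$ (a, pick J b))"
    using A J by (simp add: submatrix_def pick_UNIV)
  show ?thesis unfolding S
  proof (rule eq_matI)
    fix r s assume "r < dim_row (mat n k (\<lambda>(a, b). A $$ (a, pick J b)))"
      and "s < dim_col (mat n k (\<lambda>(a, b). A $$ (a, pick J b)))"
    then have rs: "r < n" "s < k" by auto
    have "pick J s < n" using pick_in_set_le[of s J] rs J by auto
    have "(A * unit_cols n k (pick J)) $$ (r, s) = (\<Sum>i<n. A $$ (r, i) * unit_cols n k (pick J) $$ (i, s))"
      using A rs by (simp add: unit_cols_def scalar_prod_def lessThan_atLeast0)
    also have "\<dots> = (\<Sum>i<n. if i = pick J s then A $$ (r, pick J s) else 0)"
      using rs by (intro sum.cong) (auto simp: unit_cols_def)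
    finally have *: "(A * unit_cols n k (pick J)) $$ (r, s) =
        (\<Sum>i<n. if i = pick J s then A $$ (r, pick J s) else 0)" .
    show "(A * unit_cols n k (pick J)) $$ (r, s) = mat n k (\<lambda>(a, b). A $$ (a, pick J b)) $$ (r, s)"
      unfolding * using rs \<open>pick J s < n\<close> by simp
  qed (use A in \<open>auto simp: unit_cols_def\<close>)
qed

lemma cullis_det_equal_cols:
  assumes X: "X \<in> carrier_mat n k" and pq: "p < k" "q < k" "p \<noteq> q"
    and eq: "\<And>i. i < n \<Longrightarrow> X $$ (i, p) = X $$ (i, q)"
  shows "cullis_det X = 0"
  unfolding cullis_det_alt[OF X]
proof (rule sum.neutral, clarify)
  fix J assume J: "J \<subseteq> {..<n}" "k = card J"
  have pick: "pick J a < n" if "a < k" for a using pick_in_set_le[of a J] that J by auto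
  let ?S = "submatrix X J UNIV"
  have S: "?S = mat k k (\<lambda>(a, b). X $$ (pick J a, b))" using submatrix_rows[OF X J(1)] J(2) by simp
  have "det ?S = 0"
    by (rule det_identical_columns[of _ k p q]) (use S pq eq pick in \<open>auto intro!: eq_vecI\<close>)
  then show "(- 1) ^ (\<Sum>J + \<Sum>{..<card J}) * det ?S = 0" by simp
qed

definition set_col :: "nat \<Rightarrow> nat \<Rightarrow> 'a mat \<Rightarrow> nat \<Rightarrow> (nat \<Rightarrow> 'a) \<Rightarrow> 'a mat" where
  "set_col n k X p v = mat n k (\<lambda>(i, j). if j = p then v i else X $$ (i, j))"

text \<open>Induction on the number \<open>m\<close> of leading columns that may still be arbitrary;
  \<open>lin\<close> replaces the last of them by unit vectors.\<close>

lemma multilinear_eq_zero: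
  fixes F :: "'a :: comm_ring_1 mat \<Rightarrow> 'a"
  assumes lin: "\<And>X p. X \<in> carrier_mat n k \<Longrightarrow> p < k \<Longrightarrow>
      F X = (\<Sum>i<n. X $$ (i, p) * F (set_col n k X p (delta i)))"
    and zero: "\<And>c. (\<And>j. j < k \<Longrightarrow> c j < n) \<Longrightarrow> F (unit_cols n k c) = 0"
    and X: "X \<in> carrier_mat n k"
  shows "F X = 0"
proof -
  have "F X = 0" if "m \<le> k" "X \<in> carrier_mat n k"
    "\<And>j. m \<le> j \<Longrightarrow> j < k \<Longrightarrow> \<exists>c<n. \<forall>i<n. X $$ (i, j) = delta c i" for m X
    using that
  proof (induction m arbitrary: X)
    case 0
    then obtain c where c: "\<And>j. j < k \<Longrightarrow> c j < n" "\<And>i j. i < n \<Longrightarrow> j < k \<Longrightarrow> X $$ (i, j) = delta (c j) i"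
      by (metis le0)
    then have "X = unit_cols n k c"
      using 0 by (intro eq_matI) (auto simp: unit_cols_def delta_def)
    then show ?case using zero c(1) by simp
  next
    case (Suc m)
    have "F (set_col n k X m (delta i)) = 0" if "i < n" for i
    proof (rule Suc.IH)
      fix j assume j: "m \<le> j" "j < k"
      show "\<exists>c<n. \<forall>r<n. set_col n k X m (delta i) $$ (r, j) = delta c r"
        using that j Suc.prems(3)[of j] by (cases "j = m") (auto simp: set_col_def)
    qed (use Suc.prems in \<open>auto simp: set_col_def\<close>)
    then show ?case using lin[of X m] Suc.prems by simp
  qed
  from this[of k X] show ?thesis using X by auto
qed

text \<open>Column \<open>p\<close> of \<open>A * X\<close> combines the columns of \<open>A\<close>
  with coefficients from column \<open>p\<close> of \<open>X\<close>; the other columns of the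
  product do not depend on that column.\<close>

lemma cullis_det_mult_left_col_expand:
  assumes A: "A \<in> carrier_mat n n" and X: "X \<in> carrier_mat n k" and p: "p < k"
  shows "cullis_det (A * X) = (\<Sum>i<n. X $$ (i, p) * cullis_det (A * set_col n k X p (delta i)))"
proof -
  let ?Y = "\<lambda>i. A * set_col n k X p (delta i)"
  let ?D = "\<lambda>r. cullis_det (mat_delete (A * X) r p)"
  have AX: "A * X \<in> carrier_mat n k" and Y: "?Y i \<in> carrier_mat n k" for i
    using A X by (auto simp: set_col_def)
  have "cullis_det (?Y i) = (\<Sum>r<n. (- 1) ^ (r + p) * A $$ (r, i) * ?D r)" if i: "i < n" for i
  proof -
    have "mat_delete (?Y i) r p = mat_delete (A * X) r p" for r
      by (rule mat_delete_cong_col[OF Y AX]) (use A X in \<open>auto simp: set_col_def scalar_prod_def\<close>)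
    moreover have "?Y i $$ (r, p) = A $$ (r, i)" if "r < n" for r
    proof -
      have "?Y i $$ (r, p) = (\<Sum>l<n. A $$ (r, l) * set_col n k X p (delta i) $$ (l, p))"
        using A p that by (simp add: set_col_def scalar_prod_def lessThan_atLeast0)
      also have "\<dots> = (\<Sum>l<n. if l = i then A $$ (r, i) else 0)"
        using p by (intro sum.cong) (auto simp: set_col_def delta_def)
      finally have *: "?Y i $$ (r, p) = (\<Sum>l<n. if l = i then A $$ (r, i) else 0)" .
      show ?thesis unfolding * using i by simp
    qed
    ultimately show ?thesis unfolding cullis_det_laplace[OF Y p] by simp
  qed
  then have "(\<Sum>i<n. X $$ (i, p) * cullis_det (?Y i)) =
      (\<Sum>i<n. \<Sum>r<n. X $$ (i, p) * ((- 1) ^ (r + p) * A $$ (r, i) * ?D r))"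
    by (simp add: sum_distrib_left)
  also have "\<dots> = (\<Sum>r<n. \<Sum>i<n. X $$ (i, p) * ((- 1) ^ (r + p) * A $$ (r, i) * ?D r))" by (rule sum.swap)
  also have "\<dots> = (\<Sum>r<n. (- 1) ^ (r + p) * (A * X) $$ (r, p) * ?D r)"
    using A X p
    by (intro sum.cong refl) (simp add: scalar_prod_def lessThan_atLeast0 sum_distrib_left sum_distrib_right ac_simps)
  finally show ?thesis unfolding cullis_det_laplace[OF AX p] by simp
qed

text \<open>The difference of both sides is multilinear, so unit columns suffice. Repeated columns
  give zero on both sides, and distinct ones are a permutation of increasing ones.\<close>

lemma cullis_det_mult_left_of_unit_cols:
  fixes A :: "'a :: comm_ring_1 mat"
  assumes A: "A \<in> carrier_mat n n"
    and unit: "\<And>J. J \<subseteq> {..<n} \<Longrightarrow> card J = k \<Longrightarrow>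
      cullis_det (A * unit_cols n k (pick J)) * d = cullis_det (unit_cols n k (pick J))"
    and X: "X \<in> carrier_mat n k"
  shows "cullis_det (A * X) * d = cullis_det X"
proof -
  have "cullis_det (A * X) * d - cullis_det X = 0"
  proof (rule multilinear_eq_zero[OF _ _ X])
    fix X :: "'a mat" and p assume X: "X \<in> carrier_mat n k" and p: "p < k"
    have "1\<^sub>m n * set_col n k X p v = set_col n k X p v" for v
      by (rule left_mult_one_mat[of _ n k]) (simp add: set_col_def)
    \<comment> \<open>The column expansion with the identity in place of \<open>A\<close>.\<close>
    then have "cullis_det X = (\<Sum>i<n. X $$ (i, p) * cullis_det (set_col n k X p (delta i)))"
      using cullis_det_mult_left_col_expand[of "1\<^sub>m n" n X k p] X p by simp
    then show "cullis_det (A * X) * d - cullis_det X = (\<Sum>i<n. X $$ (i, p) *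
        (cullis_det (A * set_col n k X p (delta i)) * d - cullis_det (set_col n k X p (delta i))))"
      using cullis_det_mult_left_col_expand[OF A X p]
      by (simp add: right_diff_distrib sum_subtractf sum_distrib_right mult.assoc)
  next
    fix c :: "nat \<Rightarrow> nat" assume c: "\<And>j. j < k \<Longrightarrow> c j < n"
    let ?U = "unit_cols n k c :: 'a mat"
    show "cullis_det (A * ?U) * d - cullis_det ?U = 0"
    proof (cases "inj_on c {..<k}")
      case False
      then obtain p q where pq: "p < k" "q < k" "p \<noteq> q" "c p = c q" by (auto simp: inj_on_def)
      have "cullis_det ?U = 0"
        by (rule cullis_det_equal_cols[OF _ pq(1-3)]) (use pq in \<open>auto simp: unit_cols_def\<close>)
      moreover have "cullis_det (A * ?U) = 0"
        by (rule cullis_det_equal_cols[OF _ pq(1-3)])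
          (use A pq in \<open>auto simp: unit_cols_def scalar_prod_def\<close>)
      ultimately show ?thesis by simp
    next
      case True
      define J where "J = c ` {..<k}"
      have J: "J \<subseteq> {..<n}" "card J = k" using c True by (auto simp: J_def card_image)
      let ?E = "unit_cols n k (pick J) :: 'a mat"
      \<comment> \<open>The permutation matrix that rearranges the increasing columns into the order
        of \<open>c\<close>; both determinants acquire the factor \<open>det P\<close>.\<close>
      define P where "P = mat k k (\<lambda>(a, b). if pick J a = c b then 1 else 0 :: 'a)"
      have P: "P \<in> carrier_mat k k" by (simp add: P_def)
      have "?E * P = ?U"
      proof (rule eq_matI)
        fix i j assume "i < dim_row ?U" "j < dim_col ?U"
        then have ij: "i < n" "j < k" by (auto simp: unit_cols_def)
        have finJ: "finite J" by (simp add: J_def)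
        have "(?E * P) $$ (i, j) = (\<Sum>a<k. if pick J a = c j then if i = c j then 1 else 0 else 0)"
          using ij by (auto simp: unit_cols_def P_def scalar_prod_def lessThan_atLeast0 intro!: sum.cong)
        also have "\<dots> = (\<Sum>r\<in>J. if r = c j then if i = c j then 1 else 0 else 0)"
          using sum_pick[OF finJ, of "\<lambda>r. if r = c j then if i = c j then 1 else 0 else 0"] J(2) by simp
        also have "\<dots> = (if i = c j then 1 else 0)" using ij finJ by (simp add: J_def)
        finally show "(?E * P) $$ (i, j) = ?U $$ (i, j)" using ij by (simp add: unit_cols_def)
      qed (auto simp: P_def unit_cols_def)
      then have "A * ?U = A * ?E * P" using A P by (simp add: assoc_mult_mat[of _ n n _ k _ k])
      moreover have "A * ?E \<in> carrier_mat n k" using A by simp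
      ultimately have "cullis_det (A * ?U) * d = (cullis_det (A * ?E) * d) * det P"
        using P by (simp add: cullis_det_mult_right[of _ n k] ac_simps)
      also have "\<dots> = cullis_det ?E * det P" using unit[OF J] by simp
      also have "\<dots> = cullis_det ?U"
        using cullis_det_mult_right[OF _ P, of ?E n] \<open>?E * P = ?U\<close> by simp
      finally show ?thesis by simp
    qed
  qed
  then show ?thesis by simp
qed

theorem theorem3:
  fixes n k :: nat and T :: "'a :: field mat \<Rightarrow> 'a mat"
  assumes "k \<ge> 4" and "n \<ge> k + 2" and "even (n + k)"
    and "infinite (UNIV :: 'a set) \<or> card (UNIV :: 'a set) > k"
    and "linear_map class_ring (module_mat TYPE('a) n k) (module_mat TYPE('a) n k) T"
  shows "(\<forall>X \<in> carrier_mat n k. cullis_det (T X) = cullis_det X) \<longleftrightarrow>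
    (\<exists>A \<in> carrier_mat n n. \<exists>B \<in> carrier_mat k k.
      (\<forall>J. J \<subseteq> {..<n} \<and> card J = k \<longrightarrow>
        cullis_det (submatrix A UNIV J) * det B = (- 1) ^ ((\<Sum>j\<in>J. j + 1) - (\<Sum>a=1..k. a))) \<and>
      (\<forall>X \<in> carrier_mat n k. T X = A * X * B))"
proof
  {
    interpret linear_map class_ring "module_mat TYPE('a) n k" "module_mat TYPE('a) n k" T by fact
    have "mat_linear n k T"
      using T_im T_add T_smult
      by unfold_locales (auto simp: module_mat_simps class_ring_simps)
  }
  note lin = this
  assume pres: "\<forall>X \<in> carrier_mat n k. cullis_det (T X) = cullis_det X"
  interpret mat_linear n k T by (rule lin)
  interpret cullis_preserver n k T using assms pres by unfold_locales auto
  obtain A B where AB: "A \<in> carrier_mat n n" "B \<in> carrier_mat k k"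
    "\<forall>X \<in> carrier_mat n k. T X = A * X * B" using T_two_sided_product by blast
  have "cullis_det (submatrix A UNIV J) * det B = (- 1) ^ ((\<Sum>j\<in>J. j + 1) - (\<Sum>a=1..k. a))"
    if J: "J \<subseteq> {..<n}" "card J = k" for J
  proof -
    let ?E = "unit_cols n k (pick J) :: 'a mat"
    have "A * ?E \<in> carrier_mat n k" using AB(1) by simp
    then have "cullis_det (A * ?E) * det B = cullis_det (T ?E)"
      using AB(3)[rule_format, of ?E] cullis_det_mult_right[OF _ AB(2), of "A * ?E"] by simp
    then show ?thesis unfolding cullis_det_unit_cols[OF J] using J pres AB(1) by (simp add: mult_unit_cols_pick)
  qed
  then show "\<exists>A \<in> carrier_mat n n. \<exists>B \<in> carrier_mat k k.
      (\<forall>J. J \<subseteq> {..<n} \<and> card J = k \<longrightarrow>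
        cullis_det (submatrix A UNIV J) * det B = (- 1) ^ ((\<Sum>j\<in>J. j + 1) - (\<Sum>a=1..k. a))) \<and>
      (\<forall>X \<in> carrier_mat n k. T X = A * X * B)"
    using AB by blast
next
  assume "\<exists>A \<in> carrier_mat n n. \<exists>B \<in> carrier_mat k k.
      (\<forall>J. J \<subseteq> {..<n} \<and> card J = k \<longrightarrow>
        cullis_det (submatrix A UNIV J) * det B = (- 1) ^ ((\<Sum>j\<in>J. j + 1) - (\<Sum>a=1..k. a))) \<and>
      (\<forall>X \<in> carrier_mat n k. T X = A * X * B)"
  then obtain A B where A: "A \<in> carrier_mat n n" and B: "B \<in> carrier_mat k k"
    and J: "\<And>J. J \<subseteq> {..<n} \<Longrightarrow> card J = k \<Longrightarrow>
      cullis_det (submatrix A UNIV J) * det B = (- 1) ^ ((\<Sum>j\<in>J. j + 1) - (\<Sum>a=1..k. a))"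
    and T: "\<And>X. X \<in> carrier_mat n k \<Longrightarrow> T X = A * X * B" by blast
  show "\<forall>X \<in> carrier_mat n k. cullis_det (T X) = cullis_det X"
  proof
    fix X :: "'a mat" assume X: "X \<in> carrier_mat n k"
    have "cullis_det (T X) = cullis_det (A * X) * det B"
      unfolding T[OF X] using A X by (intro cullis_det_mult_right[OF _ B, of _ n]) simp
    \<comment> \<open>The condition on \<open>A\<close> and \<open>B\<close> is the premise on unit
      columns, with \<open>d = det B\<close>.\<close>
    also have "\<dots> = cullis_det X"
      by (rule cullis_det_mult_left_of_unit_cols[OF A _ X])
        (simp only: mult_unit_cols_pick[OF A] J cullis_det_unit_cols)
    finally show "cullis_det (T X) = cullis_det X" .
  qed
qed

end
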